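(* Let $d\ge 1$ and let $\lambda\in\mathbb{R}\setminus\{0\}$. Let $C=C_d>0$ be a constant for which Nazarov's uncertainty inequality on $\mathbb{R}^d$ (recalled in the context) holds. Suppose $A$ and $B$ are measurable subsets of $\mathbb{R}^d$ of positive and finite Lebesgue measure, and suppose $t\in(0,\infty)$ is such that $2\lambda t\in\mathbb{R}\setminus\pi\mathbb{Z}$. Then for every $u_0\in L^2(\mathbb{R}^d)$, the solution $u$ of the Hermite-Schr\"odinger equation $$i\partial_t u(x,t)=H(\lambda)u(x,t)\ \ ((x,t)\in\mathbb{R}^d\times(0,\infty)),\qquad u(x,0)=u_0(x),$$ satisfies $$\int_{\mathbb{R}^d}|u_0(x)|^2\,dx\leq C\,e^{C|\sin(2|\lambda|t)|^{-d}|\lambda|^d|A||B|}\left(\int_{\mathbb{R}^d\setminus A}|u_0(x)|^2\,dx+\int_{\mathbb{R}^d\setminus B}|u(x,t)|^2\,dx\right).$$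
   Context: $|S|$ denotes the Lebesgue measure of a measurable set $S\subset\mathbb{R}^d$. Nazarov's uncertainty inequality (Nazarov, Jaming; a known theorem): there is a constant $C=C_d>0$, depending only on $d$, such that for each pair of measurable sets $A,B\subset\mathbb{R}^d$ of finite Lebesgue measure and every $f\in L^2(\mathbb{R}^d)$, $$\int_{\mathbb{R}^d}|f(x)|^2\,dx\leq C e^{C|A||B|}\left(\int_{\mathbb{R}^d\setminus A}|f(x)|^2\,dx+\int_{\mathbb{R}^d\setminus B}|\mathcal{F}f(\xi)|^2\,d\xi\right),$$ where $\mathcal{F}$ is the Fourier transform, normalized as $\mathcal{F}f(\xi)=\int_{\mathbb{R}^d}f(x)e^{-2\pi i x\cdot\xi}\,dx$ for $f\in L^1\cap L^2$ and extended to an isometry of $L^2(\mathbb{R}^d)$. The scaled Hermite operator on $\mathbb{R}^d$ is $H(\lambda)=-\Delta_{\mathbb{R}^d}+\lambda^2\|x\|^2$, where $\|\cdot\|$ is the Euclidean norm. It is understood as a self-adjoint operator on $L^2(\mathbb{R}^d)$ with spectral decomposition $H(\lambda)=\sum_{k=0}^\infty(2k+d)|\lambda|P_k(\lambda)$, where $P_k(\lambda)g=\sum_{|\nu|=k}\langle g,\Phi^\lambda_\nu\rangle\Phi^\lambda_\nu$, $\nu=(\nu_1,\dots,\nu_d)\in(\mathbb{N}\cup\{0\})^d$, $|\nu|=\sum_i\nu_i$, $\Phi^\lambda_\nu(x)=|\lambda|^{d/4}\Phi_\nu(|\lambda|^{1/2}x)$, and $\Phi_\nu$ is the tensor product of the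 one-dimensional $L^2$-normalized Hermite functions (eigenfunctions of $-\frac{d^2}{dx^2}+x^2$ with eigenvalues $2\nu_j+1$). The family $\{\Phi_\nu^\lambda\}_\nu$ is an orthonormal basis of $L^2(\mathbb{R}^d)$. The solution of the initial value problem with data $u_0\in L^2(\mathbb{R}^d)$ is $u(\cdot,t)=e^{-itH(\lambda)}u_0=\sum_{k\ge0}e^{-it(2k+d)|\lambda|}P_k(\lambda)u_0$. *)

theory Defs
  imports "HOL-Analysis.Analysis"
begin

definition L2_space :: "('a::euclidean_space \<Rightarrow> complex) set" where
  "L2_space = {f. f \<in> borel_measurable lebesgue \<and> integrable lebesgue (\<lambda>x. (norm (f x))\<^sup>2)}"

text \<open>Membership in \<open>L2_space\<close> is demanded explicitly, because a non-integrable integrand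
  would have Bochner integral \<open>0\<close>.\<close>

definition L2_tendsto :: "(nat \<Rightarrow> 'a::euclidean_space \<Rightarrow> complex) \<Rightarrow> ('a \<Rightarrow> complex) \<Rightarrow> bool" where
  "L2_tendsto F f \<longleftrightarrow> (\<forall>n. F n \<in> L2_space) \<and> f \<in> L2_space \<and>
     (\<lambda>n. LINT x|lebesgue. (norm (F n x - f x))\<^sup>2) \<longlonglongrightarrow> 0"

definition fourier_transform :: "('a::euclidean_space \<Rightarrow> complex) \<Rightarrow> 'a \<Rightarrow> complex" where
  "fourier_transform f \<xi> = (LINT x|lebesgue. f x * exp (- 2 * pi * \<i> * complex_of_real (x \<bullet> \<xi>)))"

text \<open>\<open>has_L2_fourier f g\<close>: \<open>g\<close> represents (up to null sets) the image of \<open>f\<close> under the continuous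
  extension of \<open>fourier_transform\<close> from \<open>L\<^sup>1 \<inter> L\<^sup>2\<close> to \<open>L\<^sup>2\<close>, i.e. \<open>(f, g)\<close> lies in the closure of the
  graph.  By Plancherel's theorem such a \<open>g\<close> exists for every \<open>f\<close> in \<open>L\<^sup>2\<close> and is unique almost
  everywhere.\<close>

definition has_L2_fourier ::
    "('a::euclidean_space \<Rightarrow> complex) \<Rightarrow> ('a \<Rightarrow> complex) \<Rightarrow> bool" where
  "has_L2_fourier f g \<longleftrightarrow>
     (\<exists>F. (\<forall>n. integrable lebesgue (F n)) \<and> L2_tendsto F f \<and>
          L2_tendsto (\<lambda>n. fourier_transform (F n)) g)"

definition nazarov_constant :: "'a::euclidean_space itself \<Rightarrow> real \<Rightarrow> bool" where
  "nazarov_constant TYPE('a) C \<longleftrightarrow> C > 0 \<and>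
     (\<forall>A B. \<forall>f g :: 'a \<Rightarrow> complex.
        A \<in> lmeasurable \<longrightarrow> B \<in> lmeasurable \<longrightarrow> f \<in> L2_space \<longrightarrow> has_L2_fourier f g \<longrightarrow>
        (LINT x|lebesgue. (norm (f x))\<^sup>2)
          \<le> C * exp (C * measure lebesgue A * measure lebesgue B) *
            ((LINT x:-A|lebesgue. (norm (f x))\<^sup>2) + (LINT \<xi>:-B|lebesgue. (norm (g \<xi>))\<^sup>2)))"

text \<open>Physicists' Hermite polynomials (Rodrigues' formula), and the \<open>L\<^sup>2\<close>-normalized Hermite
  functions, which satisfy \<open>- h'' + x\<^sup>2 h = (2k + 1) h\<close>.\<close>

definition hermite_poly :: "nat \<Rightarrow> real \<Rightarrow> real" where
  "hermite_poly k x = (-1) ^ k * exp (x\<^sup>2) * (deriv ^^ k) (\<lambda>y. exp (- y\<^sup>2)) x"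

definition hermite_fun :: "nat \<Rightarrow> real \<Rightarrow> real" where
  "hermite_fun k x = hermite_poly k x * exp (- x\<^sup>2 / 2) / sqrt (2 ^ k * fact k * sqrt pi)"

definition hermite_tensor :: "('n::finite \<Rightarrow> nat) \<Rightarrow> real ^ 'n \<Rightarrow> real" where
  "hermite_tensor \<nu> x = (\<Prod>i\<in>UNIV. hermite_fun (\<nu> i) (x $ i))"

definition scaled_hermite :: "real \<Rightarrow> ('n::finite \<Rightarrow> nat) \<Rightarrow> real ^ 'n \<Rightarrow> real" where
  "scaled_hermite lam \<nu> x =
     \<bar>lam\<bar> powr (real CARD('n) / 4) * hermite_tensor \<nu> (sqrt \<bar>lam\<bar> *\<^sub>R x)"

text \<open>The spectral projection \<open>P\<^sub>k(\<lambda>)\<close>; the \<open>scaled_hermite\<close> functions are real-valued, so no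
  conjugate appears in the inner product.\<close>

definition hermite_proj ::
    "real \<Rightarrow> nat \<Rightarrow> (real ^ 'n::finite \<Rightarrow> complex) \<Rightarrow> real ^ 'n \<Rightarrow> complex" where
  "hermite_proj lam k g x =
     (\<Sum>\<nu> | (\<Sum>i\<in>UNIV. \<nu> i) = k.
        (LINT y|lebesgue. g y * complex_of_real (scaled_hermite lam \<nu> y)) *
        complex_of_real (scaled_hermite lam \<nu> x))"

text \<open>\<open>hermite_calculus lam \<phi> f g\<close>: \<open>g = \<phi>(H(\<lambda>)) f\<close> in \<open>L\<^sup>2\<close>, where the self-adjoint operator
  \<open>H(\<lambda>) = - \<Delta> + \<lambda>\<^sup>2 \<parallel>x\<parallel>\<^sup>2\<close> is given by its spectral decomposition
  \<open>H(\<lambda>) = \<Sum>k. (2 k + d) \<bar>\<lambda>\<bar> P\<^sub>k(\<lambda>)\<close>.\<close>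

definition hermite_calculus ::
    "real \<Rightarrow> (real \<Rightarrow> complex) \<Rightarrow> (real ^ 'n::finite \<Rightarrow> complex) \<Rightarrow> (real ^ 'n \<Rightarrow> complex) \<Rightarrow> bool"
  where
  "hermite_calculus lam \<phi> f g \<longleftrightarrow>
     L2_tendsto
       (\<lambda>N x. \<Sum>k<N. \<phi> ((2 * real k + real CARD('n)) * \<bar>lam\<bar>) * hermite_proj lam k f x) g"

text \<open>\<open>u t\<close> is \<open>u(\<sqdot>, t) = e\<^bsup>-i t H(\<lambda>)\<^esup> u\<^sub>0\<close>, the solution of \<open>i \<partial>\<^sub>t u = H(\<lambda>) u\<close> for data
  \<open>u\<^sub>0\<close> in \<open>L\<^sup>2\<close>; at \<open>t = 0\<close> it says \<open>u(\<sqdot>, 0) = u\<^sub>0\<close> in \<open>L\<^sup>2\<close>.\<close>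

definition hermite_schrodinger_solution ::
    "real \<Rightarrow> (real ^ 'n::finite \<Rightarrow> complex) \<Rightarrow> (real \<Rightarrow> real ^ 'n \<Rightarrow> complex) \<Rightarrow> bool" where
  "hermite_schrodinger_solution lam u0 u \<longleftrightarrow>
     (\<forall>t\<ge>0. hermite_calculus lam (\<lambda>s. exp (- \<i> * complex_of_real (t * s))) u0 (u t))"

end

theory Submission
  imports Defs "HOL-Probability.Distributions" "HOL-Real_Asymp.Real_Asymp"
begin

text \<open>Write \<open>d\<close> for the dimension, \<open>\<theta> = 2 \<bar>lam\<bar> t\<close> and \<open>\<sigma> = 2 pi sin \<theta> / \<bar>lam\<bar>\<close>.  Whenever \<open>sin \<theta> \<noteq> 0\<close>, the
  propagator of the Hermite operator is a Fourier transform in disguise (Mehler's formula): the Fourier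
  transform of \<open>cis (cot \<theta> \<bar>lam\<bar> \<parallel>x\<parallel>\<^sup>2 / 2) u\<^sub>0(x)\<close> at \<open>\<xi>\<close> equals \<open>u(\<sigma> \<xi>, t)\<close> times a factor of constant modulus
  \<open>\<bar>\<sigma>\<bar> powr (d/2)\<close>.  The chirp does not change the modulus of \<open>u\<^sub>0\<close>, and the factor compensates the Jacobian of the
  dilation by \<open>\<sigma>\<close>.  Hence Nazarov's inequality for the chirped data and the sets \<open>A\<close> and \<open>B/\<sigma>\<close> is an inequality
  between the required integrals, with \<open>\<bar>A\<bar> \<bar>B\<bar> / \<bar>\<sigma>\<bar>\<^sup>d\<close> in the exponent, and
  \<open>1 / \<bar>\<sigma>\<bar> \<le> \<bar>lam\<bar> / \<bar>sin \<theta>\<bar>\<close>.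

  Mehler's formula is obtained on Hermite functions.  In one dimension
  (\<open>chirped_hermite_fun_fourier\<close>) it follows by induction from the way the raising operator is
  transformed; in several dimensions (\<open>fourier_transform_chirped_scaled_hermite\<close>) both sides are products.
  By linearity it holds for the partial sums of the spectral expansion
  (\<open>fourier_transform_chirped_partial_sum\<close>), and \<open>has_L2_fourier\<close> is designed so that it passes to limits: the
  chirped partial sums are integrable, and it remains that they converge to the chirped data, and their Fourier
  transforms to the dilated solution, in the mean.

  The second convergence is the definition of the solution at time \<open>t\<close>.  The first one is the completeness of the
  Hermite functions (\<open>hermite_expansion_tendsto\<close>).  The definition of the solution at time \<open>0\<close> says that the
  expansion of \<open>u\<^sub>0\<close> has some limit; the difference \<open>w\<close> of \<open>u\<^sub>0\<close> and this limit is orthogonal to all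
  Hermite functions, so \<open>w\<close> times a Gaussian has a vanishing Fourier transform.  That such a function vanishes
  is itself a consequence of Nazarov's inequality, for empty \<open>B\<close> and large balls \<open>A\<close>
  (\<open>nazarov_imp_fourier_injective\<close>).\<close>

section \<open>Integrals of oscillating Gaussians\<close>

lemma integral_vector_derivative_eq_0:
  fixes F f :: "real \<Rightarrow> complex"
  assumes F: "\<And>x. (F has_vector_derivative f x) (at x)"
    and f: "\<And>x. isCont f x" "integrable lborel f"
    and lim: "(F \<longlongrightarrow> 0) at_top" "(F \<longlongrightarrow> 0) at_bot"
  shows "(LINT x|lborel. f x) = 0"
proof -
  have "(LBINT x=-\<infinity>..\<infinity>. f x) = 0 - 0"
    by (rule interval_integral_FTC_integrable[where F = F])
       (use assms in \<open>auto simp: ereal_tendsto_simps set_integrable_def\<close>)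
  then show ?thesis
    by (simp add: interval_lebesgue_integral_def set_lebesgue_integral_def)
qed

lemma has_vector_derivative_iff_quotient:
  fixes f :: "real \<Rightarrow> 'a::real_normed_vector"
  shows "(f has_vector_derivative D) (at x) \<longleftrightarrow> ((\<lambda>h. (f (x + h) - f x) /\<^sub>R h) \<longlongrightarrow> D) (at 0)"
proof -
  have "norm (f (x + h) - f x - h *\<^sub>R D) / norm h = norm ((f (x + h) - f x) /\<^sub>R h - D)" if "h \<noteq> 0" for h
  proof -
    have "(f (x + h) - f x) /\<^sub>R h - D = (f (x + h) - f x - h *\<^sub>R D) /\<^sub>R h"
      using that by (simp add: scaleR_diff_right)
    then show ?thesis by (simp add: divide_inverse mult.commute)
  qed
  then have "((\<lambda>h. norm (f (x + h) - f x - h *\<^sub>R D) / norm h) \<longlongrightarrow> 0) (at 0) \<longleftrightarrow>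
      ((\<lambda>h. norm ((f (x + h) - f x) /\<^sub>R h - D)) \<longlongrightarrow> 0) (at 0)"
    by (intro filterlim_cong) (auto simp: eventually_at_filter)
  then show ?thesis
    by (simp add: has_vector_derivative_def has_derivative_at bounded_linear_scaleR_left
        tendsto_norm_zero_iff LIM_zero_iff)
qed

lemma borel_measurable_cis [measurable]: "cis \<in> borel_measurable borel"
  by (intro borel_measurable_continuous_onI continuous_intros)

text \<open>Dominated convergence applies to the difference quotients because
  \<open>\<bar>cis a - cis b\<bar> \<le> \<bar>a - b\<bar>\<close>: they are bounded by \<open>\<bar>\<phi>\<bar>\<close>, uniformly in the parameter.\<close>

lemma has_vector_derivative_integral_cis:
  fixes g :: "real \<Rightarrow> complex" and \<phi> :: "real \<Rightarrow> real"
  assumes g: "integrable lborel g" and \<phi>g: "integrable lborel (\<lambda>y. of_real (\<phi> y) * g y)"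
    and [measurable]: "\<phi> \<in> borel_measurable borel"
  shows "((\<lambda>s. LINT y|lborel. g y * cis (s * \<phi> y)) has_vector_derivative
           \<i> * (LINT y|lborel. of_real (\<phi> y) * g y * cis (s * \<phi> y))) (at s)"
proof -
  have [measurable]: "g \<in> borel_measurable borel" using g by auto
  have int: "integrable lborel (\<lambda>y. h y * cis (c * \<phi> y))" if "integrable lborel h"
    for h :: "real \<Rightarrow> complex" and c
    by (rule Bochner_Integration.integrable_bound[OF that])
       (use borel_measurable_integrable[OF that] in \<open>auto simp: norm_mult\<close>)
  define Q where "Q h y = (cis ((s + h) * \<phi> y) - cis (s * \<phi> y)) /\<^sub>R h" for h y
  have cis_deriv: "((\<lambda>r. cis (r * c)) has_vector_derivative \<i> * of_real c * cis (r * c)) (at r)"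
    for r c :: real
  proof -
    have "((\<lambda>z. exp (\<i> * (z * of_real c))) has_field_derivative
        \<i> * of_real c * exp (\<i> * (of_real r * of_real c))) (at (of_real r))"
      by (auto intro!: derivative_eq_intros)
    from has_vector_derivative_real_field[OF this] show ?thesis by (simp add: cis_conv_exp)
  qed
  have Q_lim: "((\<lambda>h. Q h y) \<longlongrightarrow> \<i> * of_real (\<phi> y) * cis (s * \<phi> y)) (at 0)" for y
    using cis_deriv[of "\<phi> y" s] by (simp add: Q_def has_vector_derivative_iff_quotient)
  have Q_bound: "norm (Q h y) \<le> \<bar>\<phi> y\<bar>" for h y
  proof -
    have "norm (cis ((s + h) * \<phi> y) - cis (s * \<phi> y)) \<le> \<bar>\<phi> y\<bar> * \<bar>h\<bar>"
    proof -
      have "cis ((s + h) * \<phi> y) - cis (s * \<phi> y) = cis (s * \<phi> y) * (cis (h * \<phi> y) - 1)"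
        by (simp add: algebra_simps cis_mult)
      then have "norm (cis ((s + h) * \<phi> y) - cis (s * \<phi> y)) = 2 * \<bar>sin (h * \<phi> y / 2)\<bar>"
        using dist_exp_i_1[of "h * \<phi> y"] by (simp add: norm_mult cis_conv_exp)
      also have "\<dots> \<le> 2 * \<bar>h * \<phi> y / 2\<bar>"
        using abs_sin_x_le_abs_x[of "h * \<phi> y / 2"] by linarith
      finally show ?thesis by (simp add: abs_mult mult.commute)
    qed
    then show ?thesis by (cases "h = 0") (auto simp: Q_def norm_mult divide_simps mult.commute simp flip: scaleR_diff_right)
  qed
  have "((\<lambda>h. LINT y|lborel. g y * Q h y) \<longlongrightarrow> (LINT y|lborel. g y * (\<i> * of_real (\<phi> y) * cis (s * \<phi> y)))) (at 0)"
    unfolding tendsto_at_iff_sequentially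
  proof (safe)
    fix X :: "nat \<Rightarrow> real" assume X: "\<forall>i. X i \<in> UNIV - {0}" "X \<longlonglongrightarrow> 0"
    then have X': "filterlim X (at 0) sequentially" by (auto simp: filterlim_at)
    show "((\<lambda>h. LINT y|lborel. g y * Q h y) \<circ> X) \<longlonglongrightarrow> (LINT y|lborel. g y * (\<i> * of_real (\<phi> y) * cis (s * \<phi> y)))"
      unfolding o_def
    proof (rule integral_dominated_convergence[where w="\<lambda>y. norm (of_real (\<phi> y) * g y)"])
      show "integrable lborel (\<lambda>y. norm (of_real (\<phi> y) * g y))" using \<phi>g by (rule integrable_norm)
      show "(\<lambda>y. g y * Q (X i) y) \<in> borel_measurable lborel" for i unfolding Q_def by measurable
      show "AE y in lborel. (\<lambda>i. g y * Q (X i) y) \<longlonglongrightarrow> g y * (\<i> * of_real (\<phi> y) * cis (s * \<phi> y))"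
        by (intro AE_I2 tendsto_intros filterlim_compose[OF Q_lim X'])
      show "AE y in lborel. norm (g y * Q (X i) y) \<le> norm (of_real (\<phi> y) * g y)" for i
        by (intro AE_I2) (use Q_bound[of "X i"] in \<open>auto simp: norm_mult mult.commute[of "norm (g _)"] intro: mult_right_mono\<close>)
    qed measurable
  qed
  moreover have "(LINT y|lborel. g y * Q h y) = ((LINT y|lborel. g y * cis ((s + h) * \<phi> y)) - (LINT y|lborel. g y * cis (s * \<phi> y))) /\<^sub>R h" for h
    unfolding Q_def by (simp flip: Bochner_Integration.integral_diff[OF int[OF g] int[OF g]] integral_scaleR_right) (simp add: algebra_simps)
  ultimately show ?thesis
    by (simp add: has_vector_derivative_iff_quotient algebra_simps flip: integral_mult_right_zero)
qed

lemma borel_measurable_poly [measurable]: "poly p \<in> borel_measurable borel" for p :: "real poly"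
  by (intro borel_measurable_continuous_onI continuous_intros)

lemma integrable_poly_gauss:
  fixes p :: "real poly"
  shows "integrable lborel (\<lambda>y. poly p y * exp (- y\<^sup>2 / 2))"
proof -
  have "integrable lborel (\<lambda>y. sqrt (2 * pi) * (\<Sum>i\<le>degree p. coeff p i * (std_normal_density y * y ^ i)))"
    by (intro integrable_mult_right Bochner_Integration.integrable_sum integrable_std_normal_moment)
  moreover have "sqrt (2 * pi) * (\<Sum>i\<le>degree p. coeff p i * (std_normal_density y * y ^ i)) = poly p y * exp (- y\<^sup>2 / 2)" for y
    by (simp add: std_normal_density_def poly_altdef sum_distrib_left sum_distrib_right mult_ac)
  ultimately show ?thesis by simp
qed

lemma tendsto_poly_gauss:
  fixes p :: "real poly"
  shows "((\<lambda>y. poly p y * exp (- y\<^sup>2 / 2)) \<longlongrightarrow> 0) at_infinity"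
proof -
  have "((\<lambda>y::real. y ^ k * exp (- y\<^sup>2 / 2)) \<longlongrightarrow> 0) at_infinity" for k
    unfolding at_infinity_eq_at_top_bot by (intro filterlim_sup; real_asymp)
  then have "((\<lambda>y. \<Sum>i\<le>degree p. coeff p i * (y ^ i * exp (- y\<^sup>2 / 2))) \<longlongrightarrow> (\<Sum>i\<le>degree p. coeff p i * 0)) at_infinity"
    by (intro tendsto_intros)
  then show ?thesis by (simp add: poly_altdef sum_distrib_left sum_distrib_right mult_ac)
qed

text \<open>Up to normalization, \<open>gauss_wave \<alpha> \<beta> p\<close> is the Fourier transform, at frequency proportional to
  \<open>\<beta>\<close>, of a polynomial times a Gaussian times the chirp \<open>cis (\<alpha> y\<^sup>2)\<close>.  Keeping the polynomial as a
  parameter turns the derivatives in \<open>\<alpha>\<close> and \<open>\<beta>\<close> and integration by parts into linear relations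
  between values of this one function, from which everything about it is deduced.\<close>

definition gauss_wave :: "real \<Rightarrow> real \<Rightarrow> real poly \<Rightarrow> complex" where
  "gauss_wave \<alpha> \<beta> p = (LINT y|lborel. of_real (poly p y * exp (- y\<^sup>2 / 2)) * cis (\<alpha> * y\<^sup>2 + \<beta> * y))"

lemma integrable_gauss_wave:
  "integrable lborel (\<lambda>y. of_real (poly p y * exp (- y\<^sup>2 / 2)) * cis (\<alpha> * y\<^sup>2 + \<beta> * y))"
  by (rule Bochner_Integration.integrable_bound[OF integrable_poly_gauss[of p]]) (auto simp: norm_mult)

lemma gauss_wave_diff: "gauss_wave \<alpha> \<beta> (p - q) = gauss_wave \<alpha> \<beta> p - gauss_wave \<alpha> \<beta> q"
  unfolding gauss_wave_def
  by (rule trans[OF Bochner_Integration.integral_cong[OF refl]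
        Bochner_Integration.integral_diff[OF integrable_gauss_wave integrable_gauss_wave]])
     (simp add: algebra_simps)

lemma gauss_wave_smult: "gauss_wave \<alpha> \<beta> (smult c p) = of_real c * gauss_wave \<alpha> \<beta> p"
  unfolding gauss_wave_def by (simp add: mult.assoc flip: integral_mult_right_zero)

lemma gauss_wave_deriv_beta:
  "((\<lambda>\<beta>. gauss_wave \<alpha> \<beta> p) has_vector_derivative \<i> * gauss_wave \<alpha> \<beta> (pCons 0 p)) (at \<beta>)"
proof -
  have *: "of_real (poly p y * exp (- y\<^sup>2 / 2)) * cis (\<alpha> * y\<^sup>2 + b * y) =
      of_real (poly p y * exp (- y\<^sup>2 / 2)) * cis (\<alpha> * y\<^sup>2 + 0 * y) * cis (b * y)" for p b y
    by (simp add: mult.assoc cis_mult)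
  show ?thesis
    unfolding gauss_wave_def
  proof (subst (1 2) *, rule has_vector_derivative_eq_rhs, rule has_vector_derivative_integral_cis, rule integrable_gauss_wave)
  qed (use integrable_gauss_wave[of "pCons 0 p" \<alpha> 0] in \<open>auto simp: mult_ac\<close>)
qed

lemma gauss_wave_deriv_alpha:
  "((\<lambda>\<alpha>. gauss_wave \<alpha> \<beta> p) has_vector_derivative \<i> * gauss_wave \<alpha> \<beta> (pCons 0 (pCons 0 p))) (at \<alpha>)"
proof -
  have *: "of_real (poly p y * exp (- y\<^sup>2 / 2)) * cis (a * y\<^sup>2 + \<beta> * y) =
      of_real (poly p y * exp (- y\<^sup>2 / 2)) * cis (0 * y\<^sup>2 + \<beta> * y) * cis (a * y\<^sup>2)" for p a y
    by (simp add: mult.assoc cis_mult add.commute)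
  show ?thesis
    unfolding gauss_wave_def
  proof (subst (1 2) *, rule has_vector_derivative_eq_rhs, rule has_vector_derivative_integral_cis, rule integrable_gauss_wave)
  qed (use integrable_gauss_wave[of "pCons 0 (pCons 0 p)" 0 \<beta>] in \<open>auto simp: mult_ac power2_eq_square\<close>)
qed

text \<open>Integration by parts: the integral of the derivative of
  \<open>p(y) exp (- y\<^sup>2/2) cis (\<alpha> y\<^sup>2 + \<beta> y)\<close> vanishes.\<close>

lemma gauss_wave_pderiv:
  "gauss_wave \<alpha> \<beta> (pderiv p) = (1 - 2 * \<i> * \<alpha>) * gauss_wave \<alpha> \<beta> (pCons 0 p) - \<i> * \<beta> * gauss_wave \<alpha> \<beta> p"
proof -
  define F where "F p y = of_real (poly p y * exp (- y\<^sup>2 / 2)) * cis (\<alpha> * y\<^sup>2 + \<beta> * y)" for p y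
  define f where "f y = F (pderiv p) y - ((1 - 2 * \<i> * \<alpha>) * F (pCons 0 p) y - \<i> * \<beta> * F p y)" for y
  have I: "integrable lborel (F p)" for p unfolding F_def by (rule integrable_gauss_wave)
  have deriv: "(F p has_vector_derivative F (pderiv p) y - ((1 - 2 * \<i> * \<alpha>) * F (pCons 0 p) y - \<i> * \<beta> * F p y)) (at y)" for p y
  proof -
    have 1: "((\<lambda>y. poly p y * exp (- y\<^sup>2 / 2)) has_real_derivative
        poly (pderiv p) y * exp (- y\<^sup>2 / 2) + poly p y * (- y * exp (- y\<^sup>2 / 2))) (at y)"
      by (auto intro!: derivative_eq_intros poly_DERIV)
    have 2: "((\<lambda>z. exp (\<i> * (\<alpha> * z\<^sup>2 + \<beta> * z))) has_field_derivative
        \<i> * (2 * \<alpha> * y + \<beta>) * exp (\<i> * (\<alpha> * (of_real y)\<^sup>2 + \<beta> * of_real y))) (at (of_real y))"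
      by (rule derivative_eq_intros refl)+ (simp add: mult_ac)
    have 3: "((\<lambda>y. cis (\<alpha> * y\<^sup>2 + \<beta> * y)) has_vector_derivative
        \<i> * (2 * \<alpha> * y + \<beta>) * cis (\<alpha> * y\<^sup>2 + \<beta> * y)) (at y)"
      using has_vector_derivative_real_field[OF 2] by (simp add: cis_conv_exp)
    have "(F p has_vector_derivative of_real (poly p y * exp (- y\<^sup>2 / 2)) * (\<i> * (2 * \<alpha> * y + \<beta>) * cis (\<alpha> * y\<^sup>2 + \<beta> * y))
      + of_real (poly (pderiv p) y * exp (- y\<^sup>2 / 2) + poly p y * (- y * exp (- y\<^sup>2 / 2))) * cis (\<alpha> * y\<^sup>2 + \<beta> * y)) (at y)"
      unfolding F_def
      by (intro has_vector_derivative_mult 3 has_vector_derivative_of_real)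
         (use 1 in \<open>simp add: has_real_derivative_iff_has_vector_derivative\<close>)
    then show ?thesis
    proof (rule has_vector_derivative_eq_rhs)
      have alg: "P * G * (\<i> * (2 * a * z + b) * W) + (P' * G + P * (- z * G)) * W =
          P' * G * W - ((1 - 2 * \<i> * a) * (z * P * G * W) - \<i> * b * (P * G * W))" for P P' G W a b z
        by (simp add: algebra_simps)
      show "of_real (poly p y * exp (- y\<^sup>2 / 2)) * (\<i> * (2 * \<alpha> * y + \<beta>) * cis (\<alpha> * y\<^sup>2 + \<beta> * y))
        + of_real (poly (pderiv p) y * exp (- y\<^sup>2 / 2) + poly p y * (- y * exp (- y\<^sup>2 / 2))) * cis (\<alpha> * y\<^sup>2 + \<beta> * y) =
        F (pderiv p) y - ((1 - 2 * \<i> * \<alpha>) * F (pCons 0 p) y - \<i> * \<beta> * F p y)"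
        using alg[of "poly p y" "exp (- y\<^sup>2 / 2)" \<alpha> y \<beta> "cis (\<alpha> * y\<^sup>2 + \<beta> * y)" "poly (pderiv p) y"]
        by (simp add: F_def)
    qed
  qed
  \<comment> \<open>the boundary terms vanish\<close>
  have lim: "(F p \<longlongrightarrow> 0) at_infinity"
    by (rule Lim_null_comparison[OF _ tendsto_norm_zero[OF tendsto_poly_gauss[of p]]])
       (auto simp: F_def norm_mult abs_mult)
  have "(LINT y|lborel. f y) = 0"
  proof (rule integral_vector_derivative_eq_0[OF deriv[of p, folded f_def]])
    show "isCont f y" for y
      unfolding f_def
      by (intro continuous_diff continuous_mult continuous_const has_vector_derivative_continuous[OF deriv])
    show "integrable lborel f" unfolding f_def by (intro Bochner_Integration.integrable_diff integrable_mult_right I)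
    show "(F p \<longlongrightarrow> 0) at_top" by (rule filterlim_mono[OF lim order_refl at_top_le_at_infinity])
    show "(F p \<longlongrightarrow> 0) at_bot" by (rule filterlim_mono[OF lim order_refl at_bot_le_at_infinity])
  qed
  moreover have "(LINT y|lborel. f y) = (LINT y|lborel. F (pderiv p) y) -
      ((1 - 2 * \<i> * \<alpha>) * (LINT y|lborel. F (pCons 0 p) y) - \<i> * \<beta> * (LINT y|lborel. F p y))"
    unfolding f_def
    by (subst Bochner_Integration.integral_diff, intro I,
        intro Bochner_Integration.integrable_diff integrable_mult_right I,
        subst Bochner_Integration.integral_diff, (intro integrable_mult_right I)+,
        simp only: integral_mult_right_zero)
  moreover have "gauss_wave \<alpha> \<beta> q = (LINT y|lborel. F q y)" for q
    by (simp only: gauss_wave_def F_def)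
  ultimately show ?thesis by simp
qed

text \<open>Formally \<open>\<integral> exp (- a y\<^sup>2) dy = sqrt (pi / a)\<close> with \<open>a = 1/2 - \<i> \<alpha>\<close>; squaring avoids the choice of
  a branch of the root.  The left-hand side is constant in \<open>\<alpha>\<close>, since its derivative vanishes by
  integration by parts, and at \<open>\<alpha> = 0\<close> it is the real Gaussian integral.\<close>

lemma gauss_wave_square: "(gauss_wave \<alpha> 0 1)\<^sup>2 * (1 / 2 - \<i> * \<alpha>) = pi"
proof -
  define D where "D a = gauss_wave a 0 1 * gauss_wave a 0 1 * (1 / 2 - \<i> * of_real a)" for a
  have "(D has_vector_derivative 0) (at a)" for a
  proof -
    define n where "n = 1 - 2 * \<i> * of_real a"
    have nz: "n \<noteq> 0" by (auto simp: n_def complex_eq_iff)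
    have half: "1 / 2 - \<i> * of_real a = n / 2" by (simp add: n_def field_simps)
    have "gauss_wave a 0 1 = n * gauss_wave a 0 (pCons 0 (pCons 0 1))"
      using gauss_wave_pderiv[of a 0 "pCons 0 1"] by (simp add: pderiv_pCons n_def)
    then have *: "gauss_wave a 0 (pCons 0 (pCons 0 1)) = gauss_wave a 0 1 / n"
      using nz by (simp add: field_simps)
    have 1: "((\<lambda>a. 1 / 2 - \<i> * of_real a) has_vector_derivative - \<i>) (at a)"
      using has_vector_derivative_real_field[of "\<lambda>z. 1 / 2 - \<i> * z" "-\<i>" a]
      by (auto intro!: derivative_eq_intros)
    show ?thesis
      unfolding D_def
      by (rule has_vector_derivative_eq_rhs[OF has_vector_derivative_mult[OF
            has_vector_derivative_mult[OF gauss_wave_deriv_alpha gauss_wave_deriv_alpha] 1]])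
         (use nz in \<open>simp add: * half field_simps flip: n_def\<close>)
  qed
  then obtain c where c: "D a = c" for a
    using has_vector_derivative_zero_constant[of UNIV D] by (auto intro: has_vector_derivative_at_within)
  have "gauss_wave 0 0 1 = of_real (LINT y|lborel. exp (- y\<^sup>2 / 2))"
    by (simp add: gauss_wave_def integral_complex_of_real)
  also have "(\<lambda>y::real. exp (- y\<^sup>2 / 2)) = (\<lambda>y. sqrt (2 * pi) * std_normal_density y)"
    by (simp add: std_normal_density_def)
  also have "(LINT y|lborel. sqrt (2 * pi) * std_normal_density y) = sqrt (2 * pi)"
    using prob_space.prob_space by simp
  finally have "D 0 = of_real (sqrt (2 * pi) * sqrt (2 * pi)) / 2"
    by (simp only: D_def of_real_mult) simp
  then have "D 0 = pi" by (simp only: real_sqrt_mult_self) simp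
  with c[of 0] c[of \<alpha>] show ?thesis by (simp add: D_def power2_eq_square)
qed

section \<open>Hermite functions on the line\<close>

primrec hermite_pol :: "nat \<Rightarrow> real poly" where
  "hermite_pol 0 = 1"
| "hermite_pol (Suc k) = smult 2 (pCons 0 (hermite_pol k)) - pderiv (hermite_pol k)"

text \<open>Each differentiation in Rodrigues' formula multiplies the polynomial factor by \<open>- 2 y\<close> and adds its
  derivative, which up to sign is the recursion of \<open>hermite_pol\<close>.\<close>

lemma hermite_poly_eq_poly: "hermite_poly k x = poly (hermite_pol k) x"
proof -
  have "(deriv ^^ k) (\<lambda>y. exp (- y\<^sup>2)) = (\<lambda>y. (-1) ^ k * poly (hermite_pol k) y * exp (- y\<^sup>2))"
  proof (induction k)
    case (Suc k)
    have "((\<lambda>y. (-1) ^ k * poly (hermite_pol k) y * exp (- y\<^sup>2)) has_real_derivative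
        (-1) ^ Suc k * poly (hermite_pol (Suc k)) y * exp (- y\<^sup>2)) (at y)" for y :: real
      by (auto intro!: derivative_eq_intros simp: algebra_simps)
    then show ?case by (auto simp: Suc.IH intro!: DERIV_imp_deriv)
  qed simp
  then show ?thesis
    by (simp add: hermite_poly_def mult_ac flip: power_mult_distrib exp_add)
qed

lemma pderiv_hermite_pol: "pderiv (hermite_pol (Suc k)) = smult (2 * real (Suc k)) (hermite_pol k)"
proof (induction k)
  case 0
  then show ?case by (simp add: pderiv_pCons pderiv_diff pderiv_smult)
next
  case (Suc k)
  let ?q = "hermite_pol k" and ?r = "hermite_pol (Suc k)"
  have "pderiv (hermite_pol (Suc (Suc k))) = smult 2 ?r + (smult 2 (pCons 0 (pderiv ?r)) - pderiv (pderiv ?r))"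
    by (subst hermite_pol.simps(2)) (simp only: pderiv_diff pderiv_smult pderiv_pCons smult_add_right add_diff_eq)
  also have "smult 2 (pCons 0 (pderiv ?r)) - pderiv (pderiv ?r) = smult (2 * real (Suc k)) ?r"
    by (simp only: Suc.IH pderiv_smult) (simp add: smult_diff_right mult.commute)
  finally show ?case
    by (simp only: smult_add_left[symmetric]) (simp add: algebra_simps)
qed

text \<open>The one-dimensional core of Mehler's formula.  The raising operator \<open>q \<mapsto> 2 y q - q'\<close> builds the Hermite
  polynomials; under the chirped Fourier transform it becomes, by integration by parts and
  differentiation in the frequency, \<open>cis (- \<theta>)\<close> times the raising operator conjugated by the chirp
  \<open>cis (- \<alpha> x\<^sup>2)\<close>.  Hence every step from \<open>k\<close> to \<open>k + 1\<close> contributes one factor \<open>cis (- \<theta>)\<close>.  For \<open>k = 0\<close> the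
  same relations give a linear differential equation with a Gaussian solution.  The value of \<open>\<alpha>\<close> makes
  \<open>(1 + 2 \<i> \<alpha>) (1 - 2 \<i> \<alpha>) (sin \<theta>)\<^sup>2 = 1\<close>, so that in the variable \<open>x\<close>, the frequency being \<open>- x / sin \<theta>\<close>, the
  resulting Gaussian has width \<open>1\<close> again.\<close>

lemma gauss_wave_hermite:
  assumes s: "sin \<theta> \<noteq> 0" and \<alpha>: "\<alpha> = cos \<theta> / (2 * sin \<theta>)"
  shows "gauss_wave \<alpha> (- x / sin \<theta>) (hermite_pol k) =
    gauss_wave \<alpha> 0 1 * cis (- real k * \<theta>) * exp (- (1 + 2 * \<i> * \<alpha>) * (of_real x)\<^sup>2 / 2) * poly (hermite_pol k) x"
proof -
  define s where "s = sin \<theta>"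
  define c where "c = 1 + 2 * \<i> * \<alpha>"
  define T where "T p x = gauss_wave \<alpha> (- x / s) p" for p x
  have s0: "of_real s \<noteq> (0::complex)" using s by (simp add: s_def)
  have c1: "c * of_real s = \<i> * cis (- \<theta>)" and c2: "(1 - 2 * \<i> * \<alpha>) * of_real s = - \<i> * cis \<theta>"
    using s by (auto simp: c_def \<alpha> s_def complex_eq_iff)
  have cc: "c * (1 - 2 * \<i> * \<alpha>) * s\<^sup>2 = 1"
  proof -
    have "c * (1 - 2 * \<i> * \<alpha>) * s\<^sup>2 = (c * s) * ((1 - 2 * \<i> * \<alpha>) * s)" by (simp add: power2_eq_square)
    also have "\<dots> = cis (- \<theta>) * cis \<theta>" unfolding c1 c2 by (simp add: algebra_simps)
    also have "\<dots> = 1" by (simp add: cis_mult)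
    finally show ?thesis .
  qed
  have T_deriv: "(T p has_vector_derivative - (\<i> / s) * T (pCons 0 p) x) (at x)" for p x
  proof -
    have "((\<lambda>x. - x / s) has_vector_derivative - 1 / s) (at x)"
      using s by (auto intro!: derivative_eq_intros simp: s_def simp flip: has_real_derivative_iff_has_vector_derivative)
    from vector_diff_chain_at[OF this gauss_wave_deriv_beta] show ?thesis
      by (simp add: T_def[abs_def] o_def scaleR_conv_of_real)
  qed
  have E_deriv: "((\<lambda>x::real. exp (d * (of_real x)\<^sup>2 / 2)) has_vector_derivative d * x * exp (d * (of_real x)\<^sup>2 / 2)) (at x)"
    for d :: complex and x
  proof -
    have "((\<lambda>z. exp (d * z\<^sup>2 / 2)) has_field_derivative d * x * exp (d * (of_real x)\<^sup>2 / 2)) (at (of_real x))"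
      by (auto intro!: derivative_eq_intros)
    from has_vector_derivative_real_field[OF this] show ?thesis .
  qed
  have T_pderiv: "T (pderiv p) x = (1 - 2 * \<i> * \<alpha>) * T (pCons 0 p) x + \<i> * x / s * T p x" for p x
    using gauss_wave_pderiv[of \<alpha> "- x / s" p] by (simp add: T_def)
  have "T (hermite_pol k) x = gauss_wave \<alpha> 0 1 * cis (- real k * \<theta>) * exp (- c * (of_real x)\<^sup>2 / 2) * poly (hermite_pol k) x"
  proof (induction k arbitrary: x)
    case 0
    have "((\<lambda>x. T 1 x * exp (c * (of_real x)\<^sup>2 / 2)) has_vector_derivative 0) (at x)" for x
    proof -
      have "(1 - 2 * \<i> * \<alpha>) * T (pCons 0 1) x = - \<i> * x / s * T 1 x"
        using T_pderiv[of 1 x] by (simp add: T_def gauss_wave_def add_eq_0_iff)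
      then have "c * s\<^sup>2 * ((1 - 2 * \<i> * \<alpha>) * T (pCons 0 1) x) = c * s\<^sup>2 * (- \<i> * x / s * T 1 x)"
        by (rule arg_cong)
      then have "c * (1 - 2 * \<i> * \<alpha>) * s\<^sup>2 * T (pCons 0 1) x = c * s\<^sup>2 * (- \<i> * x / s * T 1 x)"
        by (simp only: mult_ac)
      also have "\<dots> = - \<i> * x * c * s * T 1 x"
        using s0 by (simp add: power2_eq_square)
      finally have "c * (1 - 2 * \<i> * \<alpha>) * s\<^sup>2 * T (pCons 0 1) x = - \<i> * x * c * s * T 1 x" .
      then have *: "T (pCons 0 1) x = - \<i> * x * c * s * T 1 x"
        by (simp only: cc mult_1)
      show ?thesis
        by (rule has_vector_derivative_eq_rhs[OF has_vector_derivative_mult[OF T_deriv E_deriv]])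
           (use s0 in \<open>simp add: *\<close>)
    qed
    then obtain b where b: "T 1 x * exp (c * (of_real x)\<^sup>2 / 2) = b" for x
      using has_vector_derivative_zero_constant[of UNIV "\<lambda>x. T 1 x * exp (c * (of_real x)\<^sup>2 / 2)"]
      by (auto intro: has_vector_derivative_at_within)
    from b[of 0] b[of x] have "T 1 x * exp (c * (of_real x)\<^sup>2 / 2) = gauss_wave \<alpha> 0 1"
      by (simp add: T_def)
    then show ?case by (simp add: exp_minus field_simps)
  next
    case (Suc k)
    let ?q = "hermite_pol k"
    define M where "M = gauss_wave \<alpha> 0 1 * cis (- real k * \<theta>)"
    have IH: "T ?q = (\<lambda>x. M * (exp (- c * (of_real x)\<^sup>2 / 2) * poly ?q x))"
      unfolding M_def by (rule ext) (simp add: Suc.IH)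
    have "((\<lambda>x. M * (exp (- c * (of_real x)\<^sup>2 / 2) * poly ?q x)) has_vector_derivative
        M * (exp (- c * (of_real x)\<^sup>2 / 2) * poly (pderiv ?q) x + (- c) * x * exp (- c * (of_real x)\<^sup>2 / 2) * poly ?q x)) (at x)"
      by (intro has_vector_derivative_mult_right has_vector_derivative_mult E_deriv has_vector_derivative_of_real)
         (simp flip: has_real_derivative_iff_has_vector_derivative add: poly_DERIV)
    from vector_derivative_unique_at[OF T_deriv[of ?q x, unfolded IH] this]
    have "\<i> * s * (- (\<i> / s) * T (pCons 0 ?q) x) = \<i> * s * (M * (exp (- c * (of_real x)\<^sup>2 / 2) * poly (pderiv ?q) x + (- c) * x * exp (- c * (of_real x)\<^sup>2 / 2) * poly ?q x))"
      by simp
    then have "T (pCons 0 ?q) x = \<i> * s * (M * (exp (- c * (of_real x)\<^sup>2 / 2) * poly (pderiv ?q) x + (- c) * x * exp (- c * (of_real x)\<^sup>2 / 2) * poly ?q x))"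
      using s0 by simp
    then have xq: "T (pCons 0 ?q) x = M * exp (- c * (of_real x)\<^sup>2 / 2) * (\<i> * s * (poly (pderiv ?q) x - c * x * poly ?q x))"
      by (simp add: algebra_simps)
    have "T (hermite_pol (Suc k)) x = 2 * T (pCons 0 ?q) x - T (pderiv ?q) x"
      by (simp add: T_def gauss_wave_diff gauss_wave_smult del: smult_pCons)
    also have "\<dots> = c * T (pCons 0 ?q) x - \<i> * x / s * T ?q x"
      by (simp add: T_pderiv c_def algebra_simps)
    also have "\<dots> = M * exp (- c * (of_real x)\<^sup>2 / 2) * (\<i> * (c * s) * (poly (pderiv ?q) x - c * x * poly ?q x) - \<i> / s * x * poly ?q x)"
      unfolding xq by (simp add: IH algebra_simps)
    also have "\<i> * (c * s) * (poly (pderiv ?q) x - c * x * poly ?q x) - \<i> / s * x * poly ?q x = cis (- \<theta>) * poly (hermite_pol (Suc k)) x"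
    proof -
      have e: "\<i> / s = cis (- \<theta>) * (c - 2)"
      proof -
        have "(2 - c) * s = - \<i> * cis \<theta>" using c2 by (simp add: c_def algebra_simps)
        then have "cis (- \<theta>) * ((2 - c) * s) = - \<i>" by (simp add: cis_mult)
        then show ?thesis using s0 by (simp add: field_simps)
      qed
      show ?thesis unfolding c1 e by (simp add: algebra_simps)
    qed
    finally have step: "T (hermite_pol (Suc k)) x = M * exp (- c * (of_real x)\<^sup>2 / 2) * (cis (- \<theta>) * poly (hermite_pol (Suc k)) x)" .
    have cs: "cis (- real (Suc k) * \<theta>) = cis (- real k * \<theta>) * cis (- \<theta>)"
      by (simp add: cis_mult algebra_simps)
    show ?case unfolding step M_def cs by (simp only: mult.assoc mult.left_commute)
  qed
  then show ?thesis by (simp add: T_def s_def c_def)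
qed

lemma integrable_poly_gauss2:
  fixes p :: "real poly"
  shows "integrable lborel (\<lambda>y. poly p y * exp (- y\<^sup>2))"
  by (rule Bochner_Integration.integrable_bound[OF integrable_poly_gauss[of p]])
     (auto simp: abs_mult intro!: mult_left_mono)

lemma integral_pderiv_gauss2:
  fixes p :: "real poly"
  shows "(LINT y|lborel. poly (pderiv p) y * exp (- y\<^sup>2)) = 2 * (LINT y|lborel. poly (pCons 0 p) y * exp (- y\<^sup>2))"
proof -
  define F where "F p y = complex_of_real (poly p y * exp (- y\<^sup>2))" for p y
  define f where "f y = F (pderiv p - smult 2 (pCons 0 p)) y" for y
  have I: "integrable lborel (F p)" for p
    unfolding F_def by (intro integrable_of_real integrable_poly_gauss2)
  have deriv: "(F p has_vector_derivative F (pderiv p - smult 2 (pCons 0 p)) y) (at y)" for p y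
    unfolding F_def
    by (intro has_vector_derivative_of_real)
       (auto intro!: derivative_eq_intros simp: algebra_simps simp flip: has_real_derivative_iff_has_vector_derivative)
  have lim: "(F p \<longlongrightarrow> 0) at_infinity"
    by (rule Lim_null_comparison[OF _ tendsto_norm_zero[OF tendsto_poly_gauss[of p]]])
       (auto simp: F_def norm_mult abs_mult intro!: always_eventually mult_left_mono)
  have "(LINT y|lborel. f y) = 0"
  proof (rule integral_vector_derivative_eq_0[OF deriv[of p, folded f_def]])
    show "isCont f y" for y
      unfolding f_def by (rule has_vector_derivative_continuous[OF deriv])
    show "integrable lborel f" unfolding f_def by (rule I)
    show "(F p \<longlongrightarrow> 0) at_top" by (rule filterlim_mono[OF lim order_refl at_top_le_at_infinity])
    show "(F p \<longlongrightarrow> 0) at_bot" by (rule filterlim_mono[OF lim order_refl at_bot_le_at_infinity])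
  qed
  then have "(LINT y|lborel. poly (pderiv p - smult 2 (pCons 0 p)) y * exp (- y\<^sup>2)) = 0"
    by (simp only: f_def F_def integral_complex_of_real of_real_eq_0_iff)
  also have "(\<lambda>y. poly (pderiv p - smult 2 (pCons 0 p)) y * exp (- y\<^sup>2)) =
      (\<lambda>y. poly (pderiv p) y * exp (- y\<^sup>2) - 2 * (poly (pCons 0 p) y * exp (- y\<^sup>2)))"
    by (auto simp: algebra_simps)
  finally show ?thesis
    by (simp only: Bochner_Integration.integral_diff[OF integrable_poly_gauss2 integrable_mult_right[OF integrable_poly_gauss2]]
        integral_mult_right_zero)
qed

text \<open>Integration by parts against the weight \<open>exp (- y\<^sup>2)\<close> makes differentiation the adjoint of the raising
  operator, so both indices can be lowered together until one of them is \<open>0\<close>.\<close>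

lemma integral_hermite_pol_mult:
  "(LINT y|lborel. poly (hermite_pol j * hermite_pol k) y * exp (- y\<^sup>2)) = (if j = k then 2 ^ k * fact k * sqrt pi else 0)"
proof -
  define J where "J p = (LINT y|lborel. poly p y * exp (- y\<^sup>2))" for p :: "real poly"
  have J_diff: "J (p - q) = J p - J q" for p q
    unfolding J_def
    by (rule trans[OF Bochner_Integration.integral_cong[OF refl]
          Bochner_Integration.integral_diff[OF integrable_poly_gauss2 integrable_poly_gauss2]])
       (simp add: algebra_simps)
  have J_smult: "J (smult c p) = c * J p" for c p
    unfolding J_def by (simp add: mult.assoc flip: integral_mult_right_zero)
  have J_pderiv: "J (pderiv p) = J (smult 2 (pCons 0 p))" for p
    by (simp only: J_smult) (simp only: J_def integral_pderiv_gauss2)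
  have step: "J (hermite_pol (Suc j) * q) = J (hermite_pol j * pderiv q)" for j q
  proof -
    have "hermite_pol (Suc j) * q = smult 2 (pCons 0 (hermite_pol j * q)) - (pderiv (hermite_pol j * q) - hermite_pol j * pderiv q)"
      by (simp add: pderiv_mult algebra_simps)
    then show ?thesis by (simp only: J_diff J_pderiv)
  qed
  have J1: "J 1 = sqrt pi"
    using has_bochner_integral_even_function[OF gaussian_moment_0]
    by (simp add: J_def has_bochner_integral_iff)
  have "J (hermite_pol j * hermite_pol k) = (if j = k then 2 ^ k * fact k * sqrt pi else 0)"
  proof (induction j arbitrary: k)
    case 0
    show ?case
    proof (cases k)
      case (Suc l)
      have "J (hermite_pol (Suc l) * 1) = 0" by (simp only: step) (simp add: J_def)
      then show ?thesis by (simp add: Suc del: hermite_pol.simps(2))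
    qed (simp add: J1)
  next
    case (Suc j)
    show ?case
    proof (cases k)
      case 0
      then show ?thesis using step[of j 1] by (simp add: J_def del: hermite_pol.simps(2))
    next
      case (Suc l)
      then show ?thesis
        by (simp add: step pderiv_hermite_pol J_smult Suc.IH del: hermite_pol.simps(2))
    qed
  qed
  then show ?thesis by (simp add: J_def)
qed

definition hermite_norm :: "nat \<Rightarrow> real" where
  "hermite_norm k = sqrt (2 ^ k * fact k * sqrt pi)"

lemma hermite_norm_pos: "hermite_norm k > 0"
  by (simp add: hermite_norm_def)

lemma hermite_fun_eq: "hermite_fun k x = poly (hermite_pol k) x * exp (- x\<^sup>2 / 2) / hermite_norm k"
  by (simp add: hermite_fun_def hermite_norm_def hermite_poly_eq_poly)

lemma continuous_on_hermite_fun [continuous_intros]: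
  "continuous_on S f \<Longrightarrow> continuous_on S (\<lambda>x. hermite_fun k (f x))"
  unfolding hermite_fun_eq by (auto intro!: continuous_intros simp: hermite_norm_pos less_imp_neq[symmetric])

lemma integrable_hermite_fun: "integrable lborel (hermite_fun k)"
  unfolding hermite_fun_eq[abs_def] by (intro integrable_divide integrable_poly_gauss)

lemma hermite_fun_mult:
  "hermite_fun j x * hermite_fun k x = poly (hermite_pol j * hermite_pol k) x * exp (- x\<^sup>2) / (hermite_norm j * hermite_norm k)"
  by (simp add: hermite_fun_eq flip: exp_add)

lemma integrable_hermite_fun_mult: "integrable lborel (\<lambda>x. hermite_fun j x * hermite_fun k x)"
  unfolding hermite_fun_mult by (intro integrable_divide integrable_poly_gauss2)

lemma hermite_fun_orthonormal:
  "(LINT x|lborel. hermite_fun j x * hermite_fun k x) = (if j = k then 1 else 0)"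
proof -
  have "(LINT x|lborel. hermite_fun j x * hermite_fun k x) =
      (LINT x|lborel. poly (hermite_pol j * hermite_pol k) x * exp (- x\<^sup>2)) / (hermite_norm j * hermite_norm k)"
    unfolding hermite_fun_mult by (rule integral_divide_zero)
  then show ?thesis
    by (simp only: integral_hermite_pol_mult) (simp add: hermite_norm_def)
qed

lemma hermite_fun_recurrence:
  "x * hermite_fun k x = sqrt (real (Suc k) / 2) * hermite_fun (Suc k) x + sqrt (real k / 2) * hermite_fun (k - 1) x"
proof -
  have N: "hermite_norm (Suc k) = sqrt (2 * real (Suc k)) * hermite_norm k" for k
    by (simp add: hermite_norm_def algebra_simps flip: real_sqrt_mult)
  have r: "sqrt (real (Suc k) / 2) * 2 = sqrt (2 * real (Suc k))" for k
  proof -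
    have "sqrt (real (Suc k) / 2) * 2 = sqrt (real (Suc k) / 2) * sqrt 4" by simp
    also have "\<dots> = sqrt (2 * real (Suc k))" by (simp only: real_sqrt_mult[symmetric]) simp
    finally show ?thesis .
  qed
  have 1: "sqrt (real (Suc k) / 2) * hermite_fun (Suc k) x = poly (hermite_pol (Suc k)) x / 2 * exp (- x\<^sup>2 / 2) / hermite_norm k" for k
    using hermite_norm_pos[of k] unfolding hermite_fun_eq N r[symmetric] by (simp add: divide_simps del: hermite_pol.simps of_nat_Suc)
  have 2: "sqrt (real k / 2) * hermite_fun (k - 1) x = poly (pderiv (hermite_pol k)) x / 2 * exp (- x\<^sup>2 / 2) / hermite_norm k"
  proof (cases k)
    case (Suc l)
    define a where "a = sqrt (real (Suc l) / 2)"
    have "real (Suc l) = 2 * (a * a)" by (simp add: a_def)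
    moreover have "a > 0" by (simp add: a_def)
    ultimately show ?thesis
      using hermite_norm_pos[of l]
      unfolding Suc pderiv_hermite_pol hermite_fun_eq N r[symmetric] diff_Suc_1 a_def[symmetric]
      by (simp add: field_simps)
  qed simp
  show ?thesis
    unfolding 1 2 unfolding hermite_fun_eq using hermite_norm_pos[of k] by (simp add: field_simps)
qed

text \<open>Hermite functions are eigenfunctions of the Fourier transform preceded and followed by a chirp, with
  eigenvalue proportional to \<open>cis (- k \<theta>)\<close>; this is the factor by which \<open>exp (- \<i> t H)\<close> acts on them at \<open>t = \<theta>/2\<close>, up to a factor
  that does not depend on \<open>k\<close>.\<close>

lemma chirped_hermite_fun_fourier:
  assumes s: "sin \<theta> \<noteq> 0" and \<alpha>: "\<alpha> = cos \<theta> / (2 * sin \<theta>)"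
  shows "(LINT y|lborel. of_real (hermite_fun k y) * cis (\<alpha> * y\<^sup>2 - x * y / sin \<theta>)) =
    gauss_wave \<alpha> 0 1 * cis (- real k * \<theta>) * cis (- \<alpha> * x\<^sup>2) * hermite_fun k x"
proof -
  have gauss: "exp (- (1 + 2 * \<i> * \<alpha>) * (of_real x)\<^sup>2 / 2) = cis (- \<alpha> * x\<^sup>2) * exp (- x\<^sup>2 / 2)"
  proof -
    have "- (1 + 2 * \<i> * \<alpha>) * (of_real x)\<^sup>2 / 2 = \<i> * of_real (- \<alpha> * x\<^sup>2) + of_real (- x\<^sup>2 / 2)"
      by (simp add: field_simps)
    then show ?thesis by (simp only: exp_add cis_conv_exp exp_of_real)
  qed
  have "(LINT y|lborel. of_real (hermite_fun k y) * cis (\<alpha> * y\<^sup>2 - x * y / sin \<theta>)) =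
     gauss_wave \<alpha> (- x / sin \<theta>) (hermite_pol k) / hermite_norm k"
    unfolding gauss_wave_def hermite_fun_eq by (simp flip: integral_divide_zero)
  then show ?thesis
    unfolding gauss_wave_hermite[OF assms] gauss by (simp add: hermite_fun_eq mult_ac)
qed

lemma norm_gauss_wave:
  assumes s: "sin \<theta> \<noteq> 0" and \<alpha>: "\<alpha> = cos \<theta> / (2 * sin \<theta>)"
  shows "(norm (gauss_wave \<alpha> 0 1))\<^sup>2 = 2 * pi * \<bar>sin \<theta>\<bar>"
proof -
  have "1 / 2 - \<i> * \<alpha> = - \<i> * cis \<theta> / of_real (2 * sin \<theta>)"
    using s by (auto simp: \<alpha> complex_eq_iff)
  then have "norm (1 / 2 - \<i> * \<alpha>) = 1 / (2 * \<bar>sin \<theta>\<bar>)"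
    by (simp only: norm_divide norm_mult norm_minus_cancel norm_of_real norm_cis) simp
  moreover have "(norm (gauss_wave \<alpha> 0 1))\<^sup>2 * norm (1 / 2 - \<i> * \<alpha>) = pi"
    using gauss_wave_square[of \<alpha>] by (simp only: norm_power[symmetric] norm_mult[symmetric]) simp
  ultimately have "(norm (gauss_wave \<alpha> 0 1))\<^sup>2 * (1 / (2 * \<bar>sin \<theta>\<bar>)) = pi" by simp
  then show ?thesis using s by (simp add: field_simps)
qed

section \<open>Product integrals and square-integrable functions\<close>

lemma
  fixes f :: "'n::finite \<Rightarrow> real \<Rightarrow> 'b::{real_normed_field,banach,second_countable_topology}"
  assumes f: "\<And>i. integrable lborel (f i)"
  shows integrable_prod_vec: "integrable lborel (\<lambda>x::real^'n. \<Prod>i\<in>UNIV. f i (x $ i))"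
    and integral_prod_vec:
      "(LINT x|lborel. (\<Prod>i\<in>UNIV. f i ((x::real^'n) $ i))) = (\<Prod>i\<in>UNIV. (LINT y|lborel. f i y))"
proof -
  have [measurable]: "f i \<in> borel_measurable borel" for i using f[of i] by auto
  interpret product_sigma_finite "\<lambda>_::real^'n. lborel :: real measure" ..
  let ?P = "\<Pi>\<^sub>M b\<in>(Basis :: (real^'n) set). (lborel :: real measure)"
  let ?T = "\<lambda>g. \<Sum>b\<in>(Basis :: (real^'n) set). g b *\<^sub>R b"
  have Basis: "(Basis :: (real^'n) set) = (\<lambda>i. axis i 1) ` UNIV" by (auto simp: Basis_vec_def)
  have inj: "inj (\<lambda>i::'n. axis i (1::real))" by (auto simp: inj_on_def axis_eq_axis)
  have T: "?T g $ i = g (axis i 1)" for g i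
    unfolding Basis
    by (subst sum.reindex[OF inj]) (simp add: axis_def if_distrib if_distribR cong: if_cong)
  have idx: "axis_index (axis i (1::real)) = i" for i :: 'n
    by (auto simp: axis_index_def axis_eq_axis intro!: the_equality)
  have prod: "(\<Prod>i\<in>UNIV. f i (?T g $ i)) = (\<Prod>b\<in>Basis. f (axis_index b) (g b))" for g
    unfolding T unfolding Basis by (subst prod.reindex[OF inj]) (simp add: idx)
  have [measurable]: "(\<lambda>x::real^'n. \<Prod>i\<in>UNIV. f i (x $ i)) \<in> borel_measurable borel"
    by measurable
  have [measurable]: "?T \<in> ?P \<rightarrow>\<^sub>M borel" by measurable
  show "integrable lborel (\<lambda>x::real^'n. \<Prod>i\<in>UNIV. f i (x $ i))"
  proof (subst lborel_eq, subst integrable_distr_eq)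
    show "integrable ?P (\<lambda>g. \<Prod>i\<in>UNIV. f i (?T g $ i))"
      unfolding prod by (rule product_integrable_prod) (simp_all add: f)
  qed measurable
  have "(LINT x|lborel. (\<Prod>i\<in>UNIV. f i ((x::real^'n) $ i))) = (\<Prod>b\<in>(Basis :: (real^'n) set). (LINT y|lborel. f (axis_index b) y))"
  proof (subst lborel_eq, subst integral_distr)
    show "(LINT g|?P. (\<Prod>i\<in>UNIV. f i (?T g $ i))) = (\<Prod>b\<in>(Basis :: (real^'n) set). (LINT y|lborel. f (axis_index b) y))"
      unfolding prod by (rule product_integral_prod) (simp_all add: f)
  qed measurable
  also have "\<dots> = (\<Prod>i\<in>UNIV. (LINT y|lborel. f i y))"
    unfolding Basis by (subst prod.reindex[OF inj]) (simp add: idx)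
  finally show "(LINT x|lborel. (\<Prod>i\<in>UNIV. f i ((x::real^'n) $ i))) = (\<Prod>i\<in>UNIV. (LINT y|lborel. f i y))" .
qed

lemma L2_spaceD:
  assumes "f \<in> L2_space"
  shows "f \<in> borel_measurable lebesgue" "integrable lebesgue (\<lambda>x. (norm (f x))\<^sup>2)"
  using assms by (auto simp: L2_space_def)

lemma integrable_L2_mult:
  assumes f: "f \<in> L2_space" and g: "g \<in> L2_space"
  shows "integrable lebesgue (\<lambda>x. f x * g x)"
proof (rule Bochner_Integration.integrable_bound)
  show "integrable lebesgue (\<lambda>x. (norm (f x))\<^sup>2 + (norm (g x))\<^sup>2)"
    using f g by (intro Bochner_Integration.integrable_add L2_spaceD)
  show "(\<lambda>x. f x * g x) \<in> borel_measurable lebesgue"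
    using f g by (intro borel_measurable_times L2_spaceD)
  show "AE x in lebesgue. norm (f x * g x) \<le> norm ((norm (f x))\<^sup>2 + (norm (g x))\<^sup>2)"
  proof (rule AE_I2)
    fix x
    have "norm (f x) * norm (g x) \<le> 2 * norm (f x) * norm (g x)" by simp
    also have "\<dots> \<le> (norm (f x))\<^sup>2 + (norm (g x))\<^sup>2" by (rule sum_squares_bound)
    finally show "norm (f x * g x) \<le> norm ((norm (f x))\<^sup>2 + (norm (g x))\<^sup>2)"
      by (simp add: norm_mult)
  qed
qed

lemma L2_space_add:
  assumes f: "f \<in> L2_space" and g: "g \<in> L2_space"
  shows "(\<lambda>x. f x + g x) \<in> L2_space"
proof -
  have [measurable]: "f \<in> borel_measurable lebesgue" "g \<in> borel_measurable lebesgue"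
    using f g by (auto intro: L2_spaceD)
  have "integrable lebesgue (\<lambda>x. (norm (f x + g x))\<^sup>2)"
  proof (rule Bochner_Integration.integrable_bound)
    show "integrable lebesgue (\<lambda>x. 2 * (norm (f x))\<^sup>2 + 2 * (norm (g x))\<^sup>2)"
      using f g by (intro Bochner_Integration.integrable_add integrable_mult_right L2_spaceD)
    have "(norm (f x + g x))\<^sup>2 \<le> 2 * (norm (f x))\<^sup>2 + 2 * (norm (g x))\<^sup>2" for x
    proof -
      have "(norm (f x + g x))\<^sup>2 \<le> (norm (f x) + norm (g x))\<^sup>2" by (intro power_mono norm_triangle_ineq norm_ge_zero)
      also have "\<dots> \<le> 2 * (norm (f x))\<^sup>2 + 2 * (norm (g x))\<^sup>2"
        using sum_squares_bound[of "norm (f x)" "norm (g x)"] by (simp add: power2_sum)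
      finally show ?thesis .
    qed
    then show "AE x in lebesgue. norm ((norm (f x + g x))\<^sup>2) \<le> norm (2 * (norm (f x))\<^sup>2 + 2 * (norm (g x))\<^sup>2)"
      by (intro AE_I2) auto
  qed measurable
  then show ?thesis by (simp add: L2_space_def)
qed

lemma L2_space_mult_left: "f \<in> L2_space \<Longrightarrow> (\<lambda>x. c * f x) \<in> L2_space"
  by (auto simp: L2_space_def norm_mult power_mult_distrib)

lemma L2_space_zero: "(\<lambda>x. 0) \<in> L2_space"
  by (simp add: L2_space_def)

lemma L2_space_diff:
  assumes f: "f \<in> L2_space" and g: "g \<in> L2_space"
  shows "(\<lambda>x. f x - g x) \<in> L2_space"
  using L2_space_add[OF f L2_space_mult_left[OF g, of "-1"]] by simp

lemma weighted_mult_le: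
  fixes r u v :: real
  assumes r: "r > 0"
  shows "u * v \<le> (u\<^sup>2 / r + r * v\<^sup>2) / 2"
proof -
  have "0 \<le> (u - r * v)\<^sup>2" by simp
  then have "2 * r * (u * v) \<le> u\<^sup>2 + r * (r * v\<^sup>2)"
    by (simp add: power2_eq_square algebra_simps)
  then have "(2 * r * (u * v)) / r \<le> (u\<^sup>2 + r * (r * v\<^sup>2)) / r"
    using r by (intro divide_right_mono) auto
  then show ?thesis using r by (simp add: add_divide_distrib)
qed

text \<open>Continuity of the pairing in its first argument.  The weighted inequality between the arithmetic and the geometric mean
  replaces the Cauchy-Schwarz inequality, with a weight that tends to \<open>0\<close> as slowly as the square root of
  the error.\<close>

lemma tendsto_integral_L2_mult:
  assumes F: "L2_tendsto F f" and g: "g \<in> L2_space"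
  shows "(\<lambda>n. LINT x|lebesgue. F n x * g x) \<longlonglongrightarrow> (LINT x|lebesgue. f x * g x)"
proof -
  have mem: "F n \<in> L2_space" "f \<in> L2_space" for n using F by (auto simp: L2_tendsto_def)
  define a where "a n = (LINT x|lebesgue. (norm (F n x - f x))\<^sup>2)" for n
  define G where "G = (LINT x|lebesgue. (norm (g x))\<^sup>2)"
  \<comment> \<open>the second summand keeps the weight positive even where the error vanishes\<close>
  define r where "r n = sqrt (a n) + inverse (real (Suc n))" for n
  have a_lim: "a \<longlonglongrightarrow> 0" using F by (simp add: L2_tendsto_def a_def[abs_def])
  have a_nonneg: "a n \<ge> 0" for n by (simp add: a_def)
  have r_pos: "r n > 0" for n using a_nonneg[of n] by (simp add: r_def add_nonneg_pos)
  have r_lim: "r \<longlonglongrightarrow> 0"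
    unfolding r_def[abs_def] using tendsto_add[OF tendsto_real_sqrt[OF a_lim] LIMSEQ_inverse_real_of_nat] by simp
  have bound: "norm ((LINT x|lebesgue. F n x * g x) - (LINT x|lebesgue. f x * g x)) \<le> (r n + r n * G) / 2" for n
  proof -
    have D: "(\<lambda>x. F n x - f x) \<in> L2_space" by (intro L2_space_diff mem)
    have "(LINT x|lebesgue. F n x * g x) - (LINT x|lebesgue. f x * g x) = (LINT x|lebesgue. (F n x - f x) * g x)"
      unfolding left_diff_distrib
      by (intro Bochner_Integration.integral_diff[symmetric] integrable_L2_mult mem g)
    also have "norm \<dots> \<le> (LINT x|lebesgue. ((norm (F n x - f x))\<^sup>2 / r n + r n * (norm (g x))\<^sup>2) / 2)"
    proof (rule Bochner_Integration.integral_norm_bound_integral)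
      show "integrable lebesgue (\<lambda>x. (F n x - f x) * g x)" by (intro integrable_L2_mult D g)
      show "integrable lebesgue (\<lambda>x. ((norm (F n x - f x))\<^sup>2 / r n + r n * (norm (g x))\<^sup>2) / 2)"
        by (intro integrable_divide Bochner_Integration.integrable_add integrable_mult_right L2_spaceD(2) D g)
      fix x
      have "u * v \<le> (u\<^sup>2 / r n + r n * v\<^sup>2) / 2" for u v by (rule weighted_mult_le[OF r_pos])
      then show "norm ((F n x - f x) * g x) \<le> ((norm (F n x - f x))\<^sup>2 / r n + r n * (norm (g x))\<^sup>2) / 2"
        unfolding norm_mult .
    qed
    also have "\<dots> = (a n / r n + r n * G) / 2"
      unfolding a_def G_def integral_divide_zero
      by (subst Bochner_Integration.integral_add,
          intro integrable_divide L2_spaceD(2)[OF D], intro integrable_mult_right L2_spaceD(2)[OF g],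
          simp only: integral_divide_zero integral_mult_right_zero)
    also have "a n / r n \<le> r n"
    proof -
      have "a n \<le> r n * r n"
      proof -
        have "a n = sqrt (a n) * sqrt (a n)" using a_nonneg[of n] by simp
        also have "\<dots> \<le> r n * r n"
          using a_nonneg[of n] by (intro mult_mono) (auto simp: r_def add_nonneg_nonneg)
        finally show ?thesis .
      qed
      then show ?thesis using r_pos[of n] by (simp add: field_simps)
    qed
    finally show ?thesis by simp
  qed
  have "(\<lambda>n. (r n + r n * G) / 2) \<longlonglongrightarrow> (0 + 0 * G) / 2" by (intro tendsto_divide tendsto_add tendsto_mult r_lim tendsto_const) simp
  then have "(\<lambda>n. (LINT x|lebesgue. F n x * g x) - (LINT x|lebesgue. f x * g x)) \<longlonglongrightarrow> 0"
    by (intro Lim_null_comparison[OF always_eventually[OF allI[OF bound]]]) simp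
  then show ?thesis by (simp add: LIM_zero_iff)
qed

section \<open>Hermite functions in several variables\<close>

definition scaled_hermite_fun :: "real \<Rightarrow> nat \<Rightarrow> real \<Rightarrow> real" where
  "scaled_hermite_fun lam k x = \<bar>lam\<bar> powr (1 / 4) * hermite_fun k (sqrt \<bar>lam\<bar> * x)"

lemma scaled_hermite_eq_prod:
  assumes "lam \<noteq> 0"
  shows "scaled_hermite lam \<nu> x = (\<Prod>i\<in>UNIV. scaled_hermite_fun lam (\<nu> i) (x $ i))"
  using assms
  by (simp add: scaled_hermite_def scaled_hermite_fun_def hermite_tensor_def prod.distrib powr_power)

lemma integrable_scaled_hermite_fun:
  assumes "lam \<noteq> 0"
  shows "integrable lborel (scaled_hermite_fun lam k)"
  unfolding scaled_hermite_fun_def[abs_def]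
  using lborel_integrable_real_affine[OF integrable_hermite_fun, of "sqrt \<bar>lam\<bar>" k 0] assms
  by (intro integrable_mult_right) simp

lemma
  assumes lam: "lam \<noteq> 0"
  shows integrable_scaled_hermite_fun_mult:
      "integrable lborel (\<lambda>x. scaled_hermite_fun lam j x * scaled_hermite_fun lam k x)"
    and scaled_hermite_fun_orthonormal:
      "(LINT x|lborel. scaled_hermite_fun lam j x * scaled_hermite_fun lam k x) = (if j = k then 1 else 0)"
proof -
  define r where "r = sqrt \<bar>lam\<bar>"
  have r: "r > 0" using lam by (simp add: r_def)
  have "\<bar>lam\<bar> powr (1 / 4) * \<bar>lam\<bar> powr (1 / 4) = r"
    by (simp add: r_def powr_half_sqrt flip: powr_add)
  then have eq: "scaled_hermite_fun lam j x * scaled_hermite_fun lam k x = r * (hermite_fun j (0 + r * x) * hermite_fun k (0 + r * x))" for x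
    by (simp add: scaled_hermite_fun_def r_def[symmetric])
  show "integrable lborel (\<lambda>x. scaled_hermite_fun lam j x * scaled_hermite_fun lam k x)"
    unfolding eq using r
    by (intro integrable_mult_right lborel_integrable_real_affine[OF integrable_hermite_fun_mult]) simp
  show "(LINT x|lborel. scaled_hermite_fun lam j x * scaled_hermite_fun lam k x) = (if j = k then 1 else 0)"
    unfolding eq using lborel_integral_real_affine[of r "\<lambda>x. hermite_fun j x * hermite_fun k x" 0] r
    by (simp add: hermite_fun_orthonormal)
qed

lemma continuous_on_scaled_hermite: "continuous_on UNIV (scaled_hermite lam \<nu>)"
  unfolding scaled_hermite_def[abs_def] hermite_tensor_def
  by (intro continuous_on_mult continuous_on_const continuous_on_prod continuous_on_hermite_fun
      continuous_on_component continuous_on_scaleR continuous_on_id)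

lemma borel_measurable_scaled_hermite [measurable]: "scaled_hermite lam \<nu> \<in> borel_measurable borel"
  by (rule borel_measurable_continuous_onI[OF continuous_on_scaled_hermite])

lemma
  assumes lam: "lam \<noteq> 0"
  shows scaled_hermite_L2: "(\<lambda>x. complex_of_real (scaled_hermite lam \<nu> x)) \<in> L2_space"
    and integrable_scaled_hermite: "integrable lborel (scaled_hermite lam \<nu>)"
    and scaled_hermite_orthonormal:
      "(LINT x|lebesgue. scaled_hermite lam \<mu> x * scaled_hermite lam \<nu> x) = (if \<mu> = \<nu> then 1 else 0)"
proof -
  have eq: "scaled_hermite lam \<mu> x * scaled_hermite lam \<nu> x =
      (\<Prod>i\<in>UNIV. scaled_hermite_fun lam (\<mu> i) (x $ i) * scaled_hermite_fun lam (\<nu> i) (x $ i))" for \<mu> x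
    by (simp add: scaled_hermite_eq_prod[OF lam] prod.distrib)
  have "integrable lborel (\<lambda>x. scaled_hermite lam \<nu> x * scaled_hermite lam \<nu> x)"
    unfolding eq by (intro integrable_prod_vec integrable_scaled_hermite_fun_mult lam)
  then show "(\<lambda>x. complex_of_real (scaled_hermite lam \<nu> x)) \<in> L2_space"
    by (auto simp: L2_space_def power2_eq_square integrable_completion intro!: measurable_completion)
  show "integrable lborel (scaled_hermite lam \<nu>)"
    unfolding scaled_hermite_eq_prod[OF lam, abs_def]
    by (intro integrable_prod_vec integrable_scaled_hermite_fun lam)
  have "(LINT x|lebesgue. scaled_hermite lam \<mu> x * scaled_hermite lam \<nu> x) = (LINT x|lborel. scaled_hermite lam \<mu> x * scaled_hermite lam \<nu> x)"
    by (intro integral_completion) measurable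
  also have "\<dots> = (\<Prod>i\<in>UNIV. if \<mu> i = \<nu> i then 1 else 0)"
    unfolding eq
    by (subst integral_prod_vec)
       (auto intro: integrable_scaled_hermite_fun_mult lam simp: scaled_hermite_fun_orthonormal lam)
  also have "\<dots> = (if \<mu> = \<nu> then 1 else 0)"
    by (auto simp: fun_eq_iff)
  finally show "(LINT x|lebesgue. scaled_hermite lam \<mu> x * scaled_hermite lam \<nu> x) = (if \<mu> = \<nu> then 1 else 0)" .
qed

lemma scaled_hermite_recurrence:
  assumes lam: "lam \<noteq> 0"
  shows "sqrt \<bar>lam\<bar> * x $ j * scaled_hermite lam \<nu> x =
    sqrt (real (Suc (\<nu> j)) / 2) * scaled_hermite lam (\<nu>(j := Suc (\<nu> j))) x +
    sqrt (real (\<nu> j) / 2) * scaled_hermite lam (\<nu>(j := \<nu> j - 1)) x"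
proof -
  define R where "R = (\<Prod>i\<in>UNIV - {j}. scaled_hermite_fun lam (\<nu> i) (x $ i))"
  have upd: "scaled_hermite lam (\<nu>(j := k)) x = scaled_hermite_fun lam k (x $ j) * R" for k
    unfolding scaled_hermite_eq_prod[OF lam] R_def by (subst prod.remove[of UNIV j]) auto
  have "scaled_hermite lam \<nu> x = scaled_hermite_fun lam (\<nu> j) (x $ j) * R"
    using upd[of "\<nu> j"] by simp
  moreover have "sqrt \<bar>lam\<bar> * x $ j * scaled_hermite_fun lam k (x $ j) =
      sqrt (real (Suc k) / 2) * scaled_hermite_fun lam (Suc k) (x $ j) +
      sqrt (real k / 2) * scaled_hermite_fun lam (k - 1) (x $ j)" for k
    unfolding scaled_hermite_fun_def mult.left_commute[of _ "\<bar>lam\<bar> powr (1 / 4)"] hermite_fun_recurrence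
    by (simp add: distrib_left)
  ultimately show ?thesis
    unfolding upd by (metis distrib_right mult.assoc)
qed

text \<open>By the three-term recurrence, multiplication by a linear form maps Hermite functions to linear
  combinations of Hermite functions, so orthogonality to all of them persists under multiplication by
  powers of the form.  Stating the claim with \<open>has_bochner_integral\<close> carries integrability through the
  same induction.\<close>

lemma orthogonal_imp_polynomial_orthogonal:
  fixes w :: "real ^ 'n::finite \<Rightarrow> complex"
  assumes lam: "lam \<noteq> 0" and w: "w \<in> L2_space"
    and orth: "\<And>\<nu>. (LINT x|lebesgue. w x * of_real (scaled_hermite lam \<nu> x)) = 0"
  shows "has_bochner_integral lebesgue (\<lambda>x. w x * of_real ((x \<bullet> \<xi>) ^ n * scaled_hermite lam \<nu> x)) 0"
proof (induction n arbitrary: \<nu>)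
  case 0
  show ?case
    using integrable_L2_mult[OF w scaled_hermite_L2[OF lam]] orth by (simp add: has_bochner_integral_iff)
next
  case (Suc n)
  define r where "r = sqrt \<bar>lam\<bar>"
  have r: "r \<noteq> 0" using lam by (simp add: r_def)
  define a where "a j = \<xi> $ j * sqrt (real (Suc (\<nu> j)) / 2) / r" for j
  define b where "b j = \<xi> $ j * sqrt (real (\<nu> j) / 2) / r" for j
  have "(x \<bullet> \<xi>) ^ Suc n * scaled_hermite lam \<nu> x =
      (\<Sum>j\<in>UNIV. a j * ((x \<bullet> \<xi>) ^ n * scaled_hermite lam (\<nu>(j := Suc (\<nu> j))) x) +
                b j * ((x \<bullet> \<xi>) ^ n * scaled_hermite lam (\<nu>(j := \<nu> j - 1)) x))" for x
  proof -
    have "(x \<bullet> \<xi>) * scaled_hermite lam \<nu> x = (\<Sum>j\<in>UNIV. \<xi> $ j / r * (r * x $ j * scaled_hermite lam \<nu> x))"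
      using r by (simp add: inner_vec_def sum_distrib_left sum_distrib_right mult_ac)
    also have "\<dots> = (\<Sum>j\<in>UNIV. a j * scaled_hermite lam (\<nu>(j := Suc (\<nu> j))) x + b j * scaled_hermite lam (\<nu>(j := \<nu> j - 1)) x)"
      unfolding r_def scaled_hermite_recurrence[OF lam] by (simp add: a_def b_def r_def distrib_left mult.assoc)
    finally show ?thesis
      by (simp add: mult.commute[of "x \<bullet> \<xi>"] mult.assoc sum_distrib_left distrib_left mult.left_commute)
  qed
  then have "(\<lambda>x. w x * of_real ((x \<bullet> \<xi>) ^ Suc n * scaled_hermite lam \<nu> x)) = (\<lambda>x.
      \<Sum>j\<in>UNIV. of_real (a j) * (w x * of_real ((x \<bullet> \<xi>) ^ n * scaled_hermite lam (\<nu>(j := Suc (\<nu> j))) x)) +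
         of_real (b j) * (w x * of_real ((x \<bullet> \<xi>) ^ n * scaled_hermite lam (\<nu>(j := \<nu> j - 1)) x)))"
    by (simp add: sum_distrib_left distrib_left mult.left_commute)
  moreover have "has_bochner_integral lebesgue \<dots>
      (\<Sum>j\<in>(UNIV :: 'n set). of_real (a j) * 0 + of_real (b j) * 0)"
    by (intro has_bochner_integral_sum has_bochner_integral_add has_bochner_integral_mult_right Suc.IH)
  ultimately show ?case by (simp only: mult_zero_right add_0 sum.neutral_const)
qed

section \<open>Completeness of the Hermite functions\<close>

lemma scaled_hermite_zero:
  assumes lam: "lam \<noteq> 0"
  obtains K where "K > 0" "\<And>x :: real ^ 'n::finite. scaled_hermite lam (\<lambda>_. 0) x = K * exp (- \<bar>lam\<bar> * (norm x)\<^sup>2 / 2)"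
proof
  define c where "c = \<bar>lam\<bar> powr (1 / 4) / hermite_norm 0"
  show "c ^ CARD('n) > 0" using lam by (simp add: c_def hermite_norm_pos)
  fix x :: "real ^ 'n"
  have "scaled_hermite_fun lam 0 y = c * exp (- \<bar>lam\<bar> * y\<^sup>2 / 2)" for y
    by (simp add: scaled_hermite_fun_def hermite_fun_eq c_def power_mult_distrib)
  then have "scaled_hermite lam (\<lambda>_. 0) x = c ^ CARD('n) * exp (\<Sum>i\<in>UNIV. - \<bar>lam\<bar> * (x $ i)\<^sup>2 / 2)"
    by (simp add: scaled_hermite_eq_prod[OF lam] prod.distrib exp_sum)
  also have "(\<Sum>i\<in>UNIV. - \<bar>lam\<bar> * (x $ i)\<^sup>2 / 2) = - \<bar>lam\<bar> * (norm x)\<^sup>2 / 2"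
    unfolding power2_norm_eq_inner inner_vec_def
    by (simp add: sum_distrib_left sum_divide_distrib sum_negf power2_eq_square)
  finally show "scaled_hermite lam (\<lambda>_. 0) x = c ^ CARD('n) * exp (- \<bar>lam\<bar> * (norm x)\<^sup>2 / 2)" .
qed

text \<open>This domination justifies exchanging the exponential series with integrals against the
  Gaussian.\<close>

lemma exp_norm_scaled_hermite_zero_L2:
  fixes c :: real
  assumes lam: "lam \<noteq> 0"
  shows "(\<lambda>x :: real ^ 'n::finite. complex_of_real (exp (c * norm x) * scaled_hermite lam (\<lambda>_. 0) x)) \<in> L2_space"
proof -
  obtain K where K: "K > 0" "\<And>x :: real ^ 'n. scaled_hermite lam (\<lambda>_. 0) x = K * exp (- \<bar>lam\<bar> * (norm x)\<^sup>2 / 2)"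
    using scaled_hermite_zero[OF lam] by metis
  define M where "M = K * exp (2 * c\<^sup>2 / \<bar>lam\<bar>)"
  have bound: "(exp (c * norm x) * scaled_hermite lam (\<lambda>_. 0) x)\<^sup>2 \<le> M * scaled_hermite lam (\<lambda>_. 0) x" for x :: "real ^ 'n"
  proof -
    \<comment> \<open>completing the square absorbs the linear exponent into half of the Gaussian\<close>
    have "0 \<le> (2 * c - \<bar>lam\<bar> * norm x)\<^sup>2 / (2 * \<bar>lam\<bar>)" by simp
    also have "\<dots> = 2 * c\<^sup>2 / \<bar>lam\<bar> - 2 * (c * norm x) + \<bar>lam\<bar> * (norm x)\<^sup>2 / 2"
      using lam by (simp add: power2_diff power_mult_distrib power2_eq_square field_simps)
    finally have "2 * (c * norm x) - \<bar>lam\<bar> * (norm x)\<^sup>2 \<le> 2 * c\<^sup>2 / \<bar>lam\<bar> - \<bar>lam\<bar> * (norm x)\<^sup>2 / 2"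
      by simp
    then have "exp (2 * (c * norm x) - \<bar>lam\<bar> * (norm x)\<^sup>2) \<le> exp (2 * c\<^sup>2 / \<bar>lam\<bar> - \<bar>lam\<bar> * (norm x)\<^sup>2 / 2)"
      by simp
    then have "K\<^sup>2 * exp (2 * (c * norm x) - \<bar>lam\<bar> * (norm x)\<^sup>2) \<le> K\<^sup>2 * exp (2 * c\<^sup>2 / \<bar>lam\<bar> - \<bar>lam\<bar> * (norm x)\<^sup>2 / 2)"
      by (intro mult_left_mono) auto
    also have "K\<^sup>2 * exp (2 * c\<^sup>2 / \<bar>lam\<bar> - \<bar>lam\<bar> * (norm x)\<^sup>2 / 2) = M * scaled_hermite lam (\<lambda>_. 0) x"
    proof -
      have "exp (2 * c\<^sup>2 / \<bar>lam\<bar> - \<bar>lam\<bar> * (norm x)\<^sup>2 / 2) = exp (2 * c\<^sup>2 / \<bar>lam\<bar>) * exp (- \<bar>lam\<bar> * (norm x)\<^sup>2 / 2)"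
        by (simp flip: exp_add)
      then show ?thesis by (simp add: K(2) M_def power2_eq_square)
    qed
    also have "K\<^sup>2 * exp (2 * (c * norm x) - \<bar>lam\<bar> * (norm x)\<^sup>2) = (exp (c * norm x) * scaled_hermite lam (\<lambda>_. 0) x)\<^sup>2"
    proof -
      have "exp (2 * (c * norm x) - \<bar>lam\<bar> * (norm x)\<^sup>2) = (exp (c * norm x) * exp (- \<bar>lam\<bar> * (norm x)\<^sup>2 / 2))\<^sup>2"
        by (simp flip: exp_double exp_add)
      then show ?thesis by (simp add: K(2) power_mult_distrib mult_ac)
    qed
    finally show ?thesis .
  qed
  have "integrable lborel (\<lambda>x :: real ^ 'n. (exp (c * norm x) * scaled_hermite lam (\<lambda>_. 0) x)\<^sup>2)"
    by (rule Bochner_Integration.integrable_bound[OF integrable_mult_right[OF integrable_scaled_hermite[OF lam], of M "\<lambda>_. 0"]])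
       (use bound in \<open>auto intro: order_trans[OF _ abs_ge_self]\<close>)
  then show ?thesis
    by (auto simp: L2_space_def integrable_completion norm_mult power_mult_distrib intro!: measurable_completion)
qed

text \<open>Expanding \<open>exp (- 2 pi \<i> x \<bullet> \<xi>)\<close> into its power series gives integrals of \<open>w\<close> against polynomials times the
  Gaussian, which all vanish.\<close>

lemma fourier_transform_gauss_orthogonal:
  fixes w :: "real ^ 'n::finite \<Rightarrow> complex"
  assumes lam: "lam \<noteq> 0" and w: "w \<in> L2_space"
    and orth: "\<And>\<nu>. (LINT x|lebesgue. w x * of_real (scaled_hermite lam \<nu> x)) = 0"
  shows "fourier_transform (\<lambda>x. w x * of_real (scaled_hermite lam (\<lambda>_. 0) x)) \<xi> = 0"
proof -
  define G where "G x = w x * of_real (scaled_hermite lam (\<lambda>_. 0) x)" for x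
  define z where "z x = - 2 * pi * \<i> * complex_of_real (x \<bullet> \<xi>)" for x
  define S where "S N x = (\<Sum>n<N. z x ^ n / fact n)" for N x
  have [measurable]: "w \<in> borel_measurable lebesgue" using w by (rule L2_spaceD)
  have [measurable]: "(\<lambda>x. complex_of_real (scaled_hermite lam (\<lambda>_. 0) x)) \<in> borel_measurable (lebesgue :: (real ^ 'n) measure)"
    using scaled_hermite_L2[OF lam] by (rule L2_spaceD)
  have [measurable]: "(\<lambda>x. complex_of_real (x \<bullet> \<xi>)) \<in> borel_measurable (lebesgue :: (real ^ 'n) measure)"
    by (rule measurable_completion) measurable
  have norm_z: "norm (z x) \<le> 2 * pi * norm \<xi> * norm x" for x
    using Cauchy_Schwarz_ineq2[of x \<xi>] by (simp add: z_def norm_mult mult_ac)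
  have S_int: "(LINT x|lebesgue. G x * S N x) = 0" for N
  proof -
    have "G x * S N x = (\<Sum>n<N. (- 2 * pi * \<i>) ^ n / fact n * (w x * of_real ((x \<bullet> \<xi>) ^ n * scaled_hermite lam (\<lambda>_. 0) x)))" for x
      unfolding S_def G_def z_def sum_distrib_left
      by (intro sum.cong refl) (simp only: power_mult_distrib of_real_mult of_real_power, simp)
    moreover have "has_bochner_integral lebesgue (\<lambda>x. \<Sum>n<N. (- 2 * pi * \<i>) ^ n / fact n * (w x * of_real ((x \<bullet> \<xi>) ^ n * scaled_hermite lam (\<lambda>_. 0) x)))
        (\<Sum>n<N. (- 2 * pi * \<i>) ^ n / fact n * 0)"
      by (intro has_bochner_integral_sum has_bochner_integral_mult_right
          orthogonal_imp_polynomial_orthogonal[OF lam w orth])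
    ultimately show ?thesis by (simp add: has_bochner_integral_integral_eq)
  qed
  have "(\<lambda>N. LINT x|lebesgue. G x * S N x) \<longlonglongrightarrow> (LINT x|lebesgue. G x * exp (z x))"
  proof (rule integral_dominated_convergence)
    show "integrable lebesgue (\<lambda>x. norm (w x * of_real (exp (2 * pi * norm \<xi> * norm x) * scaled_hermite lam (\<lambda>_. 0) x)))"
      by (intro integrable_norm integrable_L2_mult w exp_norm_scaled_hermite_zero_L2 lam)
    show "(\<lambda>x. G x * exp (z x)) \<in> borel_measurable lebesgue" unfolding G_def z_def by measurable
    show "(\<lambda>x. G x * S N x) \<in> borel_measurable lebesgue" for N unfolding G_def S_def z_def by measurable
    show "AE x in lebesgue. (\<lambda>N. G x * S N x) \<longlonglongrightarrow> G x * exp (z x)"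
    proof (rule AE_I2, rule tendsto_mult_left)
      fix x
      have "(\<lambda>n. z x ^ n / fact n) sums exp (z x)"
        using exp_converges[of "z x"] by (simp add: scaleR_conv_of_real divide_inverse mult.commute)
      then show "(\<lambda>N. S N x) \<longlonglongrightarrow> exp (z x)" by (simp add: sums_def S_def)
    qed
    show "AE x in lebesgue. norm (G x * S N x) \<le> norm (w x * of_real (exp (2 * pi * norm \<xi> * norm x) * scaled_hermite lam (\<lambda>_. 0) x))" for N
    proof (rule AE_I2)
      fix x
      have "norm (S N x) \<le> (\<Sum>n<N. norm (z x) ^ n /\<^sub>R fact n)"
        unfolding S_def by (rule order_trans[OF norm_sum]) (simp add: norm_divide norm_mult norm_inverse norm_power divide_inverse mult.commute)
      also have "\<dots> \<le> (\<Sum>n. norm (z x) ^ n /\<^sub>R fact n)"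
        by (intro sum_le_suminf summable_exp_generic) auto
      also have "\<dots> = exp (norm (z x))" by (simp add: exp_def)
      also have "\<dots> \<le> exp (2 * pi * norm \<xi> * norm x)" using norm_z by simp
      finally have "norm (S N x) \<le> exp (2 * pi * norm \<xi> * norm x)" .
      then show "norm (G x * S N x) \<le> norm (w x * of_real (exp (2 * pi * norm \<xi> * norm x) * scaled_hermite lam (\<lambda>_. 0) x))"
        using mult_left_mono[of "norm (S N x)" "exp (2 * pi * norm \<xi> * norm x)" "norm (G x)"]
        by (simp add: G_def norm_mult mult_ac)
    qed
  qed
  then have "(LINT x|lebesgue. G x * exp (z x)) = 0"
    unfolding S_int by (simp add: LIMSEQ_const_iff)
  then show ?thesis by (simp add: fourier_transform_def G_def z_def)
qed

text \<open>Nazarov's inequality contains the injectivity of the Fourier transform.  With \<open>B\<close> empty the exponential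
  factor is \<open>1\<close> and the Fourier term is \<open>0\<close>, so the mass of \<open>f\<close> is at most \<open>C\<close> times its mass outside any ball,
  and the latter tends to \<open>0\<close> as the ball grows.\<close>

lemma nazarov_imp_fourier_injective:
  fixes f :: "'a::euclidean_space \<Rightarrow> complex"
  assumes C: "nazarov_constant TYPE('a) C"
    and f: "f \<in> L2_space" "integrable lebesgue f" "\<And>\<xi>. fourier_transform f \<xi> = 0"
  shows "AE x in lebesgue. f x = 0"
proof -
  have C0: "C > 0" using C by (simp add: nazarov_constant_def)
  have [measurable]: "f \<in> borel_measurable lebesgue" using f by auto
  have "fourier_transform f = (\<lambda>_. 0)" using f(3) by auto
  then have "has_L2_fourier f (\<lambda>_. 0)"
    unfolding has_L2_fourier_def
    by (intro exI[of _ "\<lambda>_. f"]) (use f in \<open>auto simp: L2_tendsto_def L2_space_zero\<close>)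
  then have bound: "(LINT x|lebesgue. (norm (f x))\<^sup>2) \<le> C * (LINT x:- cball 0 (real n)|lebesgue. (norm (f x))\<^sup>2)" for n
    using C[unfolded nazarov_constant_def, THEN conjunct2, rule_format, of "cball 0 (real n)" "{}" f "\<lambda>_. 0"] f(1)
    by (simp add: set_lebesgue_integral_def)
  have "(\<lambda>n. LINT x|lebesgue. indicator (- cball 0 (real n)) x *\<^sub>R (norm (f x))\<^sup>2) \<longlonglongrightarrow> (LINT x|(lebesgue :: 'a measure). 0)"
  proof (rule integral_dominated_convergence[OF _ _ L2_spaceD(2)[OF f(1)]])
    show "AE x in lebesgue. (\<lambda>n. indicator (- cball 0 (real n)) x *\<^sub>R (norm (f x))\<^sup>2) \<longlonglongrightarrow> 0"
    proof (rule AE_I2, rule tendsto_eventually)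
      fix x :: 'a
      have "eventually (\<lambda>n. norm x \<le> real n) sequentially"
        using eventually_ge_at_top[of "nat \<lceil>norm x\<rceil>"] by eventually_elim linarith
      then show "eventually (\<lambda>n. indicator (- cball 0 (real n)) x *\<^sub>R (norm (f x))\<^sup>2 = 0) sequentially"
        by eventually_elim simp
    qed
    show "(\<lambda>x. indicator (- cball 0 (real n)) x *\<^sub>R (norm (f x))\<^sup>2) \<in> borel_measurable lebesgue" for n
      using borel_measurable_integrable[OF L2_spaceD(2)[OF f(1)]] fmeasurableD[OF lmeasurable_cball[of "0::'a" "real n"]]
      by (intro borel_measurable_scaleR borel_measurable_indicator) auto
    show "AE x in lebesgue. norm (indicator (- cball 0 (real n)) x *\<^sub>R (norm (f x))\<^sup>2) \<le> (norm (f x))\<^sup>2" for n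
      by (intro AE_I2) (simp add: indicator_def)
  qed simp
  then have "(\<lambda>n. C * (LINT x:- cball 0 (real n)|lebesgue. (norm (f x))\<^sup>2)) \<longlonglongrightarrow> C * 0"
    unfolding set_lebesgue_integral_def by (intro tendsto_mult_left) simp
  then have "(LINT x|lebesgue. (norm (f x))\<^sup>2) \<le> C * 0"
    by (rule LIMSEQ_le_const) (use bound in auto)
  moreover have "0 \<le> (LINT x|lebesgue. (norm (f x))\<^sup>2)" by simp
  ultimately have "(LINT x|lebesgue. (norm (f x))\<^sup>2) = 0" by simp
  then show ?thesis
    using integral_nonneg_eq_0_iff_AE[OF L2_spaceD(2)[OF f(1)]] by simp
qed

text \<open>The Fourier transform of \<open>w\<close> times the Gaussian vanishes, and the Gaussian has no zeros.\<close>

lemma nazarov_imp_hermite_complete: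
  fixes w :: "real ^ 'n::finite \<Rightarrow> complex"
  assumes C: "nazarov_constant TYPE(real ^ 'n) C"
    and lam: "lam \<noteq> 0" and w: "w \<in> L2_space"
    and orth: "\<And>\<nu>. (LINT x|lebesgue. w x * of_real (scaled_hermite lam \<nu> x)) = 0"
  shows "AE x in lebesgue. w x = 0"
proof -
  obtain K where K: "K > 0" "\<And>x :: real ^ 'n. scaled_hermite lam (\<lambda>_. 0) x = K * exp (- \<bar>lam\<bar> * (norm x)\<^sup>2 / 2)"
    using scaled_hermite_zero[OF lam] by metis
  let ?f = "\<lambda>x. w x * of_real (scaled_hermite lam (\<lambda>_. 0) x)"
  have [measurable]: "w \<in> borel_measurable lebesgue" using w by (rule L2_spaceD)
  have [measurable]: "(\<lambda>x. complex_of_real (scaled_hermite lam (\<lambda>_. 0) x)) \<in> borel_measurable (lebesgue :: (real ^ 'n) measure)"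
    using scaled_hermite_L2[OF lam] by (rule L2_spaceD)
  have "integrable lebesgue (\<lambda>x. (norm (?f x))\<^sup>2)"
  proof (rule Bochner_Integration.integrable_bound)
    show "integrable lebesgue (\<lambda>x. K\<^sup>2 * (norm (w x))\<^sup>2)"
      by (intro integrable_mult_right L2_spaceD w)
    have "(norm (?f x))\<^sup>2 \<le> K\<^sup>2 * (norm (w x))\<^sup>2" for x
    proof -
      have "scaled_hermite lam (\<lambda>_. 0) x \<le> K * 1"
        unfolding K(2) using K(1) by (intro mult_left_mono) auto
      moreover have "scaled_hermite lam (\<lambda>_. 0) x \<ge> 0" using K(1) by (simp add: K(2))
      ultimately have "(scaled_hermite lam (\<lambda>_. 0) x)\<^sup>2 \<le> K\<^sup>2" by (intro power_mono) auto
      then have "(scaled_hermite lam (\<lambda>_. 0) x)\<^sup>2 * (norm (w x))\<^sup>2 \<le> K\<^sup>2 * (norm (w x))\<^sup>2"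
        by (rule mult_right_mono) simp
      then show ?thesis by (simp add: norm_mult power_mult_distrib mult.commute)
    qed
    then show "AE x in lebesgue. norm ((norm (?f x))\<^sup>2) \<le> norm (K\<^sup>2 * (norm (w x))\<^sup>2)" by simp
  qed measurable
  then have "?f \<in> L2_space" by (simp add: L2_space_def)
  from nazarov_imp_fourier_injective[OF C this integrable_L2_mult[OF w scaled_hermite_L2[OF lam]]
      fourier_transform_gauss_orthogonal[OF lam w orth]]
  show ?thesis using K(1) by (simp add: K(2))
qed

section \<open>Dilations and chirps\<close>

lemma lebesgue_eq_density_scaleR:
  fixes c :: real
  assumes "c \<noteq> 0"
  shows "(lebesgue :: 'a::euclidean_space measure) = density (distr lebesgue lebesgue ((*\<^sub>R) c)) (\<lambda>_. ennreal (\<bar>c\<bar> ^ DIM('a)))"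
proof -
  have "(\<lambda>x::'a. 0 + (\<Sum>j\<in>Basis. (c * (x \<bullet> j)) *\<^sub>R j)) = (*\<^sub>R) c"
    unfolding scaleR_scaleR[symmetric] scaleR_sum_right[symmetric] euclidean_representation by auto
  then show ?thesis
    using lebesgue_affine_euclidean[of "\<lambda>_::'a. c" 0] assms by simp
qed

lemma
  fixes f :: "'a::euclidean_space \<Rightarrow> 'b::{banach, second_countable_topology}"
  assumes c: "c \<noteq> 0" and f: "f \<in> borel_measurable lebesgue"
  shows integrable_lebesgue_scaleR_iff:
      "integrable lebesgue (\<lambda>x. f (c *\<^sub>R x)) \<longleftrightarrow> integrable lebesgue f"
    and integral_lebesgue_scaleR:
      "\<bar>c\<bar> ^ DIM('a) *\<^sub>R (LINT x|lebesgue. f (c *\<^sub>R x)) = (LINT x|lebesgue. f x)"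
proof -
  have [measurable]: "f \<in> borel_measurable (distr lebesgue lebesgue ((*\<^sub>R) c))" using f by simp
  have "integrable lebesgue f \<longleftrightarrow> integrable (distr lebesgue lebesgue ((*\<^sub>R) c)) (\<lambda>x. \<bar>c\<bar> ^ DIM('a) *\<^sub>R f x)"
    by (subst lebesgue_eq_density_scaleR[OF c], subst integrable_density) auto
  also have "\<dots> \<longleftrightarrow> integrable lebesgue (\<lambda>x. f (c *\<^sub>R x))"
  proof -
    define a where "a = \<bar>c\<bar> ^ DIM('a)"
    have a: "a \<noteq> 0" using c by (simp add: a_def)
    have "integrable lebesgue (\<lambda>x. a *\<^sub>R f (c *\<^sub>R x)) \<longleftrightarrow> integrable lebesgue (\<lambda>x. f (c *\<^sub>R x))"
      using integrable_scaleR_right[of "inverse a" lebesgue "\<lambda>x. a *\<^sub>R f (c *\<^sub>R x)"] a by auto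
    then show ?thesis
      unfolding a_def[symmetric] using f by (subst integrable_distr_eq) auto
  qed
  finally show "integrable lebesgue (\<lambda>x. f (c *\<^sub>R x)) \<longleftrightarrow> integrable lebesgue f" ..
  have "(LINT x|lebesgue. f x) = (LINT x|distr lebesgue lebesgue ((*\<^sub>R) c). \<bar>c\<bar> ^ DIM('a) *\<^sub>R f x)"
    by (subst lebesgue_eq_density_scaleR[OF c], subst integral_density) auto
  also have "\<dots> = (LINT x|lebesgue. \<bar>c\<bar> ^ DIM('a) *\<^sub>R f (c *\<^sub>R x))"
    using f by (subst integral_distr) auto
  finally show "\<bar>c\<bar> ^ DIM('a) *\<^sub>R (LINT x|lebesgue. f (c *\<^sub>R x)) = (LINT x|lebesgue. f x)" by simp
qed

lemma L2_space_scaleR: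
  fixes f :: "'a::euclidean_space \<Rightarrow> complex"
  assumes c: "c \<noteq> 0" and f: "f \<in> L2_space"
  shows "(\<lambda>x. f (c *\<^sub>R x)) \<in> L2_space"
proof -
  have "(\<lambda>x. f (c *\<^sub>R x)) \<in> borel_measurable lebesgue"
    by (rule measurable_compose[OF lebesgue_measurable_scaling L2_spaceD(1)[OF f]])
  moreover have "integrable lebesgue (\<lambda>x. (norm (f (c *\<^sub>R x)))\<^sup>2)"
    using integrable_lebesgue_scaleR_iff[OF c borel_measurable_integrable[OF L2_spaceD(2)[OF f]]] L2_spaceD(2)[OF f]
    by simp
  ultimately show ?thesis by (simp add: L2_space_def)
qed

lemma L2_tendsto_scaleR:
  fixes f :: "'a::euclidean_space \<Rightarrow> complex"
  assumes c: "c \<noteq> 0" and F: "L2_tendsto F f"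
  shows "L2_tendsto (\<lambda>n x. F n (c *\<^sub>R x)) (\<lambda>x. f (c *\<^sub>R x))"
proof -
  have mem: "F n \<in> L2_space" "f \<in> L2_space" for n using F by (auto simp: L2_tendsto_def)
  have "(LINT x|lebesgue. (norm (F n (c *\<^sub>R x) - f (c *\<^sub>R x)))\<^sup>2) =
      (LINT x|lebesgue. (norm (F n x - f x))\<^sup>2) / \<bar>c\<bar> ^ DIM('a)" for n
    using integral_lebesgue_scaleR[OF c borel_measurable_integrable[OF L2_spaceD(2)[OF L2_space_diff[OF mem]]], of n] c
    by (simp add: field_simps)
  moreover have "(\<lambda>n. (LINT x|lebesgue. (norm (F n x - f x))\<^sup>2) / \<bar>c\<bar> ^ DIM('a)) \<longlonglongrightarrow> 0 / \<bar>c\<bar> ^ DIM('a)"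
    using F c by (intro tendsto_divide tendsto_const) (auto simp: L2_tendsto_def)
  ultimately show ?thesis
    using mem by (simp add: L2_tendsto_def L2_space_scaleR[OF c])
qed

lemma L2_tendsto_mult_const_norm:
  assumes F: "L2_tendsto F f" and m: "m \<in> borel_measurable lebesgue" "\<And>x. norm (m x) = c"
  shows "L2_tendsto (\<lambda>n x. m x * F n x) (\<lambda>x. m x * f x)"
proof -
  have mem: "F n \<in> L2_space" "f \<in> L2_space" for n using F by (auto simp: L2_tendsto_def)
  have L2: "(\<lambda>x. m x * g x) \<in> L2_space" if "g \<in> L2_space" for g
    using that m by (auto simp: L2_space_def norm_mult power_mult_distrib)
  have "(LINT x|lebesgue. (norm (m x * F n x - m x * f x))\<^sup>2) = c\<^sup>2 * (LINT x|lebesgue. (norm (F n x - f x))\<^sup>2)" for n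
    by (simp add: norm_mult m(2) power_mult_distrib flip: right_diff_distrib)
  moreover have "(\<lambda>n. c\<^sup>2 * (LINT x|lebesgue. (norm (F n x - f x))\<^sup>2)) \<longlonglongrightarrow> c\<^sup>2 * 0"
    using F by (intro tendsto_mult_left) (simp add: L2_tendsto_def)
  ultimately show ?thesis using mem by (simp add: L2_tendsto_def L2)
qed

section \<open>The propagator as a Fourier transform\<close>

text \<open>The substitution \<open>y = sqrt \<bar>lam\<bar> x\<close> in the unscaled formula; \<open>\<sigma>\<close> converts the frequency \<open>\<xi>\<close> of the
  Fourier kernel \<open>exp (- 2 pi \<i> x \<xi>)\<close> into the position variable of the solution.\<close>

lemma chirped_scaled_hermite_fun_fourier:
  assumes lam: "lam \<noteq> 0" and s: "sin \<theta> \<noteq> 0" and \<alpha>: "\<alpha> = cos \<theta> / (2 * sin \<theta>)"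
    and \<sigma>: "\<sigma> = 2 * pi * sin \<theta> / \<bar>lam\<bar>"
  shows "(LINT x|lborel. of_real (scaled_hermite_fun lam k x) * cis (\<alpha> * \<bar>lam\<bar> * x\<^sup>2 - 2 * pi * x * \<xi>)) =
    gauss_wave \<alpha> 0 1 / sqrt \<bar>lam\<bar> * (cis (- real k * \<theta>) * cis (- \<alpha> * \<bar>lam\<bar> * (\<sigma> * \<xi>)\<^sup>2) *
      scaled_hermite_fun lam k (\<sigma> * \<xi>))"
proof -
  define r where "r = sqrt \<bar>lam\<bar>"
  have r: "r > 0" "\<bar>lam\<bar> = r\<^sup>2" using lam by (auto simp: r_def)
  define q where "q = \<bar>lam\<bar> powr (1 / 4)"
  define G where "G y = of_real (hermite_fun k y) * cis (\<alpha> * y\<^sup>2 - (r * \<sigma> * \<xi>) * y / sin \<theta>)" for y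
  have "of_real (scaled_hermite_fun lam k x) * cis (\<alpha> * \<bar>lam\<bar> * x\<^sup>2 - 2 * pi * x * \<xi>) = of_real q * G (0 + r * x)" for x
  proof -
    have "\<alpha> * \<bar>lam\<bar> * x\<^sup>2 - 2 * pi * x * \<xi> = \<alpha> * (r * x)\<^sup>2 - (r * \<sigma> * \<xi>) * (r * x) / sin \<theta>"
      using s r(1) unfolding \<sigma> r(2) by (simp add: field_simps power2_eq_square)
    then show ?thesis by (simp add: G_def scaled_hermite_fun_def q_def r_def)
  qed
  then have "(LINT x|lborel. of_real (scaled_hermite_fun lam k x) * cis (\<alpha> * \<bar>lam\<bar> * x\<^sup>2 - 2 * pi * x * \<xi>)) =
      of_real q * (LINT x|lborel. G (0 + r * x))"
    by simp
  also have "(LINT x|lborel. G (0 + r * x)) = (LINT y|lborel. G y) / r"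
    using lborel_integral_real_affine[of r G 0] r by (simp add: scaleR_conv_of_real)
  also have "(LINT y|lborel. G y) = gauss_wave \<alpha> 0 1 * cis (- real k * \<theta>) * cis (- \<alpha> * (r * \<sigma> * \<xi>)\<^sup>2) * hermite_fun k (r * \<sigma> * \<xi>)"
    unfolding G_def by (rule chirped_hermite_fun_fourier[OF s \<alpha>])
  also have "- \<alpha> * (r * \<sigma> * \<xi>)\<^sup>2 = - \<alpha> * \<bar>lam\<bar> * (\<sigma> * \<xi>)\<^sup>2"
    unfolding r(2) by (simp add: power_mult_distrib)
  finally show ?thesis
    by (simp add: scaled_hermite_fun_def q_def r_def[symmetric] mult_ac)
qed

lemma cis_sum: "cis (\<Sum>i\<in>I. f i) = (\<Prod>i\<in>I. cis (f i))"
  by (induction I rule: infinite_finite_induct) (auto simp flip: cis_mult)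

lemma norm_vec_square: "(norm (x :: real ^ 'n::finite))\<^sup>2 = (\<Sum>i\<in>UNIV. (x $ i)\<^sup>2)"
  unfolding power2_norm_eq_inner inner_vec_def by (simp add: power2_eq_square)

definition chirp :: "real \<Rightarrow> 'a::real_normed_vector \<Rightarrow> complex" where
  "chirp a x = cis (a * (norm x)\<^sup>2)"

lemma norm_chirp [simp]: "norm (chirp a x) = 1"
  by (simp add: chirp_def)

lemma borel_measurable_chirp [measurable]: "chirp a \<in> borel_measurable borel"
  unfolding chirp_def[abs_def] by measurable

lemma integrable_chirped_scaled_hermite:
  assumes lam: "lam \<noteq> 0"
  shows "integrable lebesgue (\<lambda>x. chirp a x * of_real (scaled_hermite lam \<nu> x) * exp (- 2 * pi * \<i> * complex_of_real (x \<bullet> \<xi>)))"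
proof -
  have "integrable lborel (\<lambda>x. chirp a x * of_real (scaled_hermite lam \<nu> x) * exp (- 2 * pi * \<i> * complex_of_real (x \<bullet> \<xi>)))"
  proof (rule Bochner_Integration.integrable_bound[OF integrable_scaled_hermite[OF lam, of \<nu>]])
    show "(\<lambda>x. chirp a x * of_real (scaled_hermite lam \<nu> x) * exp (- 2 * pi * \<i> * complex_of_real (x \<bullet> \<xi>))) \<in> borel_measurable lborel"
      by measurable
  qed (simp add: norm_mult)
  then show ?thesis by (subst integrable_completion) auto
qed

text \<open>Chirp, Fourier kernel and Hermite function all factor over the coordinates.  The phases of the
  one-dimensional factors multiply to one that depends on \<open>\<nu>\<close> through \<open>\<bar>\<nu>\<bar>\<close> only, hence is constant on each
  eigenspace of the Hermite operator.\<close>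

lemma fourier_transform_chirped_scaled_hermite:
  fixes \<nu> :: "'n::finite \<Rightarrow> nat"
  assumes lam: "lam \<noteq> 0" and s: "sin \<theta> \<noteq> 0" and \<alpha>: "\<alpha> = cos \<theta> / (2 * sin \<theta>)"
    and \<sigma>: "\<sigma> = 2 * pi * sin \<theta> / \<bar>lam\<bar>"
  shows "fourier_transform (\<lambda>x. chirp (\<alpha> * \<bar>lam\<bar>) x * of_real (scaled_hermite lam \<nu> x)) \<xi> =
    (gauss_wave \<alpha> 0 1 / sqrt \<bar>lam\<bar>) ^ CARD('n) * (cis (- real (\<Sum>i\<in>UNIV. \<nu> i) * \<theta>) *
      chirp (- \<alpha> * \<bar>lam\<bar>) (\<sigma> *\<^sub>R \<xi>) * scaled_hermite lam \<nu> (\<sigma> *\<^sub>R \<xi>))"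
proof -
  define f where "f i x = of_real (scaled_hermite_fun lam (\<nu> i) x) * cis (\<alpha> * \<bar>lam\<bar> * x\<^sup>2 - 2 * pi * x * \<xi> $ i)" for i x
  have [measurable]: "scaled_hermite_fun lam k \<in> borel_measurable borel" for k
    using integrable_scaled_hermite_fun[OF lam, of k] by auto
  have f: "integrable lborel (f i)" for i
    unfolding f_def
    by (rule Bochner_Integration.integrable_bound[OF integrable_scaled_hermite_fun[OF lam, of "\<nu> i"]])
       (auto simp: norm_mult)
  have eq: "chirp (\<alpha> * \<bar>lam\<bar>) x * of_real (scaled_hermite lam \<nu> x) * exp (- 2 * pi * \<i> * complex_of_real (x \<bullet> \<xi>)) = (\<Prod>i\<in>UNIV. f i (x $ i))" for x
  proof -
    have "exp (- 2 * pi * \<i> * complex_of_real (x \<bullet> \<xi>)) = cis (- 2 * pi * (x \<bullet> \<xi>))"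
      by (simp add: cis_conv_exp mult_ac)
    then have "chirp (\<alpha> * \<bar>lam\<bar>) x * exp (- 2 * pi * \<i> * complex_of_real (x \<bullet> \<xi>)) =
        cis (\<Sum>i\<in>UNIV. \<alpha> * \<bar>lam\<bar> * (x $ i)\<^sup>2 - 2 * pi * x $ i * \<xi> $ i)"
      by (simp add: chirp_def cis_mult norm_vec_square inner_vec_def sum_distrib_left sum_subtractf sum_negf mult.assoc)
    then show ?thesis
      by (simp add: f_def prod.distrib scaled_hermite_eq_prod[OF lam] cis_sum mult_ac)
  qed
  have "fourier_transform (\<lambda>x. chirp (\<alpha> * \<bar>lam\<bar>) x * of_real (scaled_hermite lam \<nu> x)) \<xi> = (LINT x|lborel. (\<Prod>i\<in>UNIV. f i (x $ i)))"
    unfolding fourier_transform_def eq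
    by (rule integral_completion, rule borel_measurable_integrable, rule integrable_prod_vec, rule f)
  also have "\<dots> = (\<Prod>i\<in>UNIV. gauss_wave \<alpha> 0 1 / sqrt \<bar>lam\<bar> * (cis (- real (\<nu> i) * \<theta>) * cis (- \<alpha> * \<bar>lam\<bar> * (\<sigma> * \<xi> $ i)\<^sup>2) *
      scaled_hermite_fun lam (\<nu> i) (\<sigma> * \<xi> $ i)))"
    unfolding integral_prod_vec[OF f] unfolding f_def
    by (simp only: chirped_scaled_hermite_fun_fourier[OF lam s \<alpha> \<sigma>])
  also have "\<dots> = (gauss_wave \<alpha> 0 1 / sqrt \<bar>lam\<bar>) ^ CARD('n) * (cis (\<Sum>i\<in>UNIV. - real (\<nu> i) * \<theta>) *
      cis (\<Sum>i\<in>UNIV. - \<alpha> * \<bar>lam\<bar> * (\<sigma> * \<xi> $ i)\<^sup>2) * scaled_hermite lam \<nu> (\<sigma> *\<^sub>R \<xi>))"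
    unfolding cis_sum scaled_hermite_eq_prod[OF lam]
    by (simp only: prod.distrib prod_constant of_real_prod vector_scaleR_component real_scaleR_def)
  also have "(\<Sum>i\<in>UNIV. - \<alpha> * \<bar>lam\<bar> * (\<sigma> * \<xi> $ i)\<^sup>2) = - \<alpha> * \<bar>lam\<bar> * (norm (\<sigma> *\<^sub>R \<xi>))\<^sup>2"
    unfolding norm_vec_square by (simp only: vector_scaleR_component real_scaleR_def sum_distrib_left)
  also have "(\<Sum>i\<in>UNIV. - real (\<nu> i) * \<theta>) = - real (\<Sum>i\<in>UNIV. \<nu> i) * \<theta>"
    by (simp add: sum_distrib_right sum_negf)
  finally show ?thesis by (simp only: chirp_def)
qed

section \<open>Spectral expansions\<close>

lemma finite_degree_less: "finite {\<nu> :: 'n::finite \<Rightarrow> nat. (\<Sum>i\<in>UNIV. \<nu> i) < N}"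
proof (rule finite_subset)
  show "{\<nu> :: 'n \<Rightarrow> nat. (\<Sum>i\<in>UNIV. \<nu> i) < N} \<subseteq> (\<Pi>\<^sub>E i\<in>UNIV. {..N})"
  proof (clarsimp simp: PiE_def extensional_def)
    fix \<nu> :: "'n \<Rightarrow> nat" and i assume "(\<Sum>i\<in>UNIV. \<nu> i) < N"
    with member_le_sum[of i UNIV \<nu>] show "\<nu> i \<le> N" by simp
  qed
qed (auto intro: finite_PiE)

definition hermite_coeff :: "real \<Rightarrow> (real ^ 'n::finite \<Rightarrow> complex) \<Rightarrow> ('n \<Rightarrow> nat) \<Rightarrow> complex" where
  "hermite_coeff lam f \<nu> = (LINT y|lebesgue. f y * complex_of_real (scaled_hermite lam \<nu> y))"

lemma sum_hermite_proj:
  "(\<Sum>k<N. \<phi> k * hermite_proj lam k f x) =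
    (\<Sum>\<nu> | (\<Sum>i\<in>UNIV. \<nu> i) < N. \<phi> (\<Sum>i\<in>UNIV. \<nu> i) * hermite_coeff lam f \<nu> * complex_of_real (scaled_hermite lam \<nu> x))"
  (is "?L = sum ?h ?I")
proof -
  have "?L = (\<Sum>k\<in>{..<N}. sum ?h {\<nu> \<in> ?I. (\<Sum>i\<in>UNIV. \<nu> i) = k})"
    unfolding hermite_proj_def sum_distrib_left
    by (intro sum.cong refl) (auto simp: hermite_coeff_def)
  also have "\<dots> = sum ?h ?I"
    by (rule sum.group) (auto simp: finite_degree_less)
  finally show ?thesis .
qed

lemma hermite_coeff_partial_sum:
  assumes lam: "lam \<noteq> 0" and N: "(\<Sum>i\<in>UNIV. \<nu> i) < N"
  shows "(LINT x|lebesgue. (\<Sum>k<N. hermite_proj lam k f x) * complex_of_real (scaled_hermite lam \<nu> x)) = hermite_coeff lam f \<nu>"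
proof -
  let ?I = "{\<mu>. (\<Sum>i\<in>UNIV. \<mu> i) < N}" and ?\<Phi> = "\<lambda>\<mu> x. complex_of_real (scaled_hermite lam \<mu> x)"
  have "(\<Sum>k<N. hermite_proj lam k f x) * ?\<Phi> \<nu> x = (\<Sum>\<mu>\<in>?I. hermite_coeff lam f \<mu> * (?\<Phi> \<mu> x * ?\<Phi> \<nu> x))" for x
    using sum_hermite_proj[of "\<lambda>_. 1" lam f x N] by (simp add: sum_distrib_right mult.assoc)
  then have "(LINT x|lebesgue. (\<Sum>k<N. hermite_proj lam k f x) * ?\<Phi> \<nu> x) =
      (LINT x|lebesgue. (\<Sum>\<mu>\<in>?I. hermite_coeff lam f \<mu> * (?\<Phi> \<mu> x * ?\<Phi> \<nu> x)))"
    by simp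
  also have "\<dots> = (\<Sum>\<mu>\<in>?I. LINT x|lebesgue. hermite_coeff lam f \<mu> * (?\<Phi> \<mu> x * ?\<Phi> \<nu> x))"
    by (intro Bochner_Integration.integral_sum integrable_mult_right integrable_L2_mult scaled_hermite_L2 lam)
  also have "\<dots> = (\<Sum>\<mu>\<in>?I. if \<mu> = \<nu> then hermite_coeff lam f \<mu> else 0)"
  proof (intro sum.cong refl)
    fix \<mu>
    have "(LINT x|lebesgue. ?\<Phi> \<mu> x * ?\<Phi> \<nu> x) = of_real (if \<mu> = \<nu> then 1 else 0)"
      unfolding of_real_mult[symmetric] integral_complex_of_real scaled_hermite_orthonormal[OF lam] ..
    then show "(LINT x|lebesgue. hermite_coeff lam f \<mu> * (?\<Phi> \<mu> x * ?\<Phi> \<nu> x)) = (if \<mu> = \<nu> then hermite_coeff lam f \<mu> else 0)"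
      by simp
  qed
  also have "\<dots> = hermite_coeff lam f \<nu>"
    using N finite_degree_less[where 'n='a] by (simp add: sum.delta)
  finally show ?thesis .
qed

text \<open>If the spectral expansion of \<open>f\<close> converges at all, then its limit has the same Hermite coefficients as
  \<open>f\<close>, by orthonormality, and therefore agrees with \<open>f\<close> almost everywhere, by completeness.\<close>

lemma hermite_expansion_tendsto:
  fixes f g :: "real ^ 'n::finite \<Rightarrow> complex"
  assumes C: "nazarov_constant TYPE(real ^ 'n) C" and lam: "lam \<noteq> 0" and f: "f \<in> L2_space"
    and g: "L2_tendsto (\<lambda>N x. \<Sum>k<N. hermite_proj lam k f x) g"
  shows "L2_tendsto (\<lambda>N x. \<Sum>k<N. hermite_proj lam k f x) f"
proof -
  have g2: "g \<in> L2_space" using g by (simp add: L2_tendsto_def)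
  have "(LINT x|lebesgue. (f x - g x) * of_real (scaled_hermite lam \<nu> x)) = 0" for \<nu>
  proof -
    have "(\<lambda>N. LINT x|lebesgue. (\<Sum>k<N. hermite_proj lam k f x) * of_real (scaled_hermite lam \<nu> x)) \<longlonglongrightarrow>
        (LINT x|lebesgue. g x * of_real (scaled_hermite lam \<nu> x))"
      by (rule tendsto_integral_L2_mult[OF g scaled_hermite_L2[OF lam]])
    moreover have "(\<lambda>N. LINT x|lebesgue. (\<Sum>k<N. hermite_proj lam k f x) * of_real (scaled_hermite lam \<nu> x)) \<longlonglongrightarrow>
        hermite_coeff lam f \<nu>"
      by (rule tendsto_eventually)
         (use eventually_gt_at_top[of "\<Sum>i\<in>UNIV. \<nu> i"] in \<open>eventually_elim, simp add: hermite_coeff_partial_sum[OF lam]\<close>)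
    ultimately have "(LINT x|lebesgue. g x * of_real (scaled_hermite lam \<nu> x)) = hermite_coeff lam f \<nu>"
      by (rule LIMSEQ_unique)
    then show ?thesis
      unfolding left_diff_distrib
      by (subst Bochner_Integration.integral_diff) (simp_all add: integrable_L2_mult f g2 scaled_hermite_L2[OF lam] hermite_coeff_def)
  qed
  then have "AE x in lebesgue. f x - g x = 0"
    by (rule nazarov_imp_hermite_complete[OF C lam L2_space_diff[OF f g2]])
  then have ae: "AE x in lebesgue. f x = g x" by simp
  have S: "(\<lambda>x. \<Sum>k<N. hermite_proj lam k f x) \<in> L2_space" for N using g by (simp add: L2_tendsto_def)
  have "(LINT x|lebesgue. (norm ((\<Sum>k<N. hermite_proj lam k f x) - f x))\<^sup>2) =
      (LINT x|lebesgue. (norm ((\<Sum>k<N. hermite_proj lam k f x) - g x))\<^sup>2)" for N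
    by (rule integral_cong_AE)
       (use ae in \<open>auto intro!: borel_measurable_integrable[OF L2_spaceD(2)[OF L2_space_diff]] S f g2\<close>)
  then show ?thesis using g f by (simp add: L2_tendsto_def)
qed

text \<open>The factor relating the Fourier transform of the chirped data to the dilated solution.  The phase
  \<open>cis (d \<theta>/2)\<close> compensates the ground state energy \<open>d \<bar>lam\<bar>\<close> of the Hermite operator.\<close>

definition schrodinger_factor :: "real \<Rightarrow> real \<Rightarrow> real ^ 'n::finite \<Rightarrow> complex" where
  "schrodinger_factor lam \<theta> \<xi> = (let \<alpha> = cos \<theta> / (2 * sin \<theta>) in
     (gauss_wave \<alpha> 0 1 / sqrt \<bar>lam\<bar>) ^ CARD('n) * cis (real CARD('n) * \<theta> / 2) *
     chirp (- \<alpha> * \<bar>lam\<bar>) ((2 * pi * sin \<theta> / \<bar>lam\<bar>) *\<^sub>R \<xi>))"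

lemma norm_schrodinger_factor:
  fixes \<xi> :: "real ^ 'n::finite"
  assumes lam: "lam \<noteq> 0" and s: "sin \<theta> \<noteq> 0"
  shows "(norm (schrodinger_factor lam \<theta> \<xi>))\<^sup>2 = \<bar>2 * pi * sin \<theta> / \<bar>lam\<bar>\<bar> ^ CARD('n)"
proof -
  define g where "g = norm (gauss_wave (cos \<theta> / (2 * sin \<theta>)) 0 1)"
  have "norm (schrodinger_factor lam \<theta> \<xi>) = (g / sqrt \<bar>lam\<bar>) ^ CARD('n)"
    by (simp add: schrodinger_factor_def Let_def norm_mult norm_power norm_divide g_def)
  then have "(norm (schrodinger_factor lam \<theta> \<xi>))\<^sup>2 = ((g / sqrt \<bar>lam\<bar>)\<^sup>2) ^ CARD('n)"
    by (simp only: power_mult[symmetric] mult.commute)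
  also have "\<dots> = (g\<^sup>2 / \<bar>lam\<bar>) ^ CARD('n)"
    by (simp add: power_divide)
  also have "\<dots> = \<bar>2 * pi * sin \<theta> / \<bar>lam\<bar>\<bar> ^ CARD('n)"
    unfolding g_def norm_gauss_wave[OF s refl] by (simp add: abs_mult)
  finally show ?thesis .
qed

text \<open>The identity between the propagator and the Fourier transform on finite spectral sums, obtained from
  single Hermite functions by linearity.\<close>

lemma fourier_transform_chirped_partial_sum:
  fixes f :: "real ^ 'n::finite \<Rightarrow> complex"
  assumes lam: "lam \<noteq> 0" and \<theta>: "\<theta> = 2 * \<bar>lam\<bar> * t" and s: "sin \<theta> \<noteq> 0"
  shows "fourier_transform (\<lambda>x. chirp (cos \<theta> / (2 * sin \<theta>) * \<bar>lam\<bar>) x * (\<Sum>k<N. hermite_proj lam k f x)) \<xi> =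
    schrodinger_factor lam \<theta> \<xi> *
      (\<Sum>k<N. exp (- \<i> * complex_of_real (t * ((2 * real k + real CARD('n)) * \<bar>lam\<bar>))) *
        hermite_proj lam k f ((2 * pi * sin \<theta> / \<bar>lam\<bar>) *\<^sub>R \<xi>))"
    and "integrable lebesgue (\<lambda>x. chirp (cos \<theta> / (2 * sin \<theta>) * \<bar>lam\<bar>) x * (\<Sum>k<N. hermite_proj lam k f x))"
proof -
  define \<alpha> where "\<alpha> = cos \<theta> / (2 * sin \<theta>)"
  define \<sigma> where "\<sigma> = 2 * pi * sin \<theta> / \<bar>lam\<bar>"
  define M where "M = (gauss_wave \<alpha> 0 1 / sqrt \<bar>lam\<bar>) ^ CARD('n)"
  let ?I = "{\<nu> :: 'n \<Rightarrow> nat. (\<Sum>i\<in>UNIV. \<nu> i) < N}"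
  let ?e = "\<lambda>\<xi> x. exp (- 2 * pi * \<i> * complex_of_real (x \<bullet> \<xi>))"
  let ?c = "hermite_coeff lam f"
  let ?\<Phi> = "\<lambda>\<nu> x. complex_of_real (scaled_hermite lam \<nu> x)"
  have eq: "chirp (\<alpha> * \<bar>lam\<bar>) x * (\<Sum>k<N. hermite_proj lam k f x) * ?e \<xi> x =
      (\<Sum>\<nu>\<in>?I. ?c \<nu> * (chirp (\<alpha> * \<bar>lam\<bar>) x * ?\<Phi> \<nu> x * ?e \<xi> x))" for x \<xi>
    using sum_hermite_proj[of "\<lambda>_. 1" lam f x N]
    by (simp add: sum_distrib_left sum_distrib_right mult_ac)
  have int: "integrable lebesgue (\<lambda>x. ?c \<nu> * (chirp (\<alpha> * \<bar>lam\<bar>) x * ?\<Phi> \<nu> x * ?e \<xi> x))" for \<nu> \<xi>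
    by (intro integrable_mult_right integrable_chirped_scaled_hermite lam)
  have "integrable lebesgue (\<lambda>x. chirp (\<alpha> * \<bar>lam\<bar>) x * (\<Sum>k<N. hermite_proj lam k f x) * ?e 0 x)"
    unfolding eq by (intro Bochner_Integration.integrable_sum int)
  then show "integrable lebesgue (\<lambda>x. chirp (cos \<theta> / (2 * sin \<theta>) * \<bar>lam\<bar>) x * (\<Sum>k<N. hermite_proj lam k f x))"
    by (simp add: \<alpha>_def)
  have phase: "cis (- real k * \<theta>) = cis (real CARD('n) * \<theta> / 2) *
      exp (- \<i> * complex_of_real (t * ((2 * real k + real CARD('n)) * \<bar>lam\<bar>)))" for k
  proof -
    have "- \<i> * complex_of_real (t * ((2 * real k + real CARD('n)) * \<bar>lam\<bar>)) =
        \<i> * complex_of_real (- (t * ((2 * real k + real CARD('n)) * \<bar>lam\<bar>)))" by simp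
    then show ?thesis
      unfolding cis_conv_exp[symmetric] cis_mult by (simp only: cis_mult cis_conv_exp[symmetric])
        (simp add: \<theta> algebra_simps)
  qed
  have "fourier_transform (\<lambda>x. chirp (\<alpha> * \<bar>lam\<bar>) x * (\<Sum>k<N. hermite_proj lam k f x)) \<xi> =
      (\<Sum>\<nu>\<in>?I. ?c \<nu> * fourier_transform (\<lambda>x. chirp (\<alpha> * \<bar>lam\<bar>) x * ?\<Phi> \<nu> x) \<xi>)"
    unfolding fourier_transform_def eq
    by (subst Bochner_Integration.integral_sum[OF int]) (simp only: integral_mult_right_zero)
  also have "\<dots> = (\<Sum>\<nu>\<in>?I. M * chirp (- \<alpha> * \<bar>lam\<bar>) (\<sigma> *\<^sub>R \<xi>) *
      (cis (- real (\<Sum>i\<in>UNIV. \<nu> i) * \<theta>) * ?c \<nu> * ?\<Phi> \<nu> (\<sigma> *\<^sub>R \<xi>)))"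
    unfolding fourier_transform_chirped_scaled_hermite[OF lam s \<alpha>_def \<sigma>_def] M_def[symmetric]
    by (simp only: mult_ac)
  also have "\<dots> = M * chirp (- \<alpha> * \<bar>lam\<bar>) (\<sigma> *\<^sub>R \<xi>) *
      (\<Sum>k<N. cis (- real k * \<theta>) * hermite_proj lam k f (\<sigma> *\<^sub>R \<xi>))"
    by (simp only: sum_hermite_proj sum_distrib_left)
  also have "\<dots> = M * chirp (- \<alpha> * \<bar>lam\<bar>) (\<sigma> *\<^sub>R \<xi>) * (cis (real CARD('n) * \<theta> / 2) *
      (\<Sum>k<N. exp (- \<i> * complex_of_real (t * ((2 * real k + real CARD('n)) * \<bar>lam\<bar>))) * hermite_proj lam k f (\<sigma> *\<^sub>R \<xi>)))"
    by (simp only: phase sum_distrib_left mult.assoc)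
  finally show "fourier_transform (\<lambda>x. chirp (cos \<theta> / (2 * sin \<theta>) * \<bar>lam\<bar>) x * (\<Sum>k<N. hermite_proj lam k f x)) \<xi> =
    schrodinger_factor lam \<theta> \<xi> *
      (\<Sum>k<N. exp (- \<i> * complex_of_real (t * ((2 * real k + real CARD('n)) * \<bar>lam\<bar>))) *
        hermite_proj lam k f ((2 * pi * sin \<theta> / \<bar>lam\<bar>) *\<^sub>R \<xi>))"
    by (simp only: schrodinger_factor_def Let_def M_def \<alpha>_def \<sigma>_def mult_ac)
qed

section \<open>The uncertainty inequality\<close>

theorem theorem1p1:
  fixes lam C t :: real
    and A B :: "(real ^ 'n::finite) set"
    and u0 :: "real ^ 'n \<Rightarrow> complex"
    and u :: "real \<Rightarrow> real ^ 'n \<Rightarrow> complex"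
  assumes lam: "lam \<noteq> 0"
    and C: "nazarov_constant TYPE(real ^ 'n) C"
    and A: "A \<in> lmeasurable" "measure lebesgue A > 0"
    and B: "B \<in> lmeasurable" "measure lebesgue B > 0"
    and t: "t > 0" "\<not> (\<exists>k::int. 2 * lam * t = pi * of_int k)"
    and u0: "u0 \<in> L2_space"
    and u: "hermite_schrodinger_solution lam u0 u"
  shows "(LINT x|lebesgue. (norm (u0 x))\<^sup>2)
    \<le> C * exp (C * \<bar>sin (2 * \<bar>lam\<bar> * t)\<bar> powi (- int CARD('n)) * \<bar>lam\<bar> ^ CARD('n) *
                measure lebesgue A * measure lebesgue B) *
      ((LINT x:-A|lebesgue. (norm (u0 x))\<^sup>2) + (LINT x:-B|lebesgue. (norm (u t x))\<^sup>2))"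
proof -
  define \<theta> where "\<theta> = 2 * \<bar>lam\<bar> * t"
  define \<sigma> where "\<sigma> = 2 * pi * sin \<theta> / \<bar>lam\<bar>"
  define a where "a = cos \<theta> / (2 * sin \<theta>) * \<bar>lam\<bar>"
  define S where "S N x = (\<Sum>k<N. hermite_proj lam k u0 x)" for N and x :: "real ^ 'n"
  define B' where "B' = {\<xi>. \<sigma> *\<^sub>R \<xi> \<in> B}"
  define f where "f x = chirp a x * u0 x" for x
  define g where "g \<xi> = schrodinger_factor lam \<theta> \<xi> * u t (\<sigma> *\<^sub>R \<xi>)" for \<xi>
  have s: "sin \<theta> \<noteq> 0"
  proof
    assume "sin \<theta> = 0"
    then obtain i :: int where i: "\<theta> = i * pi" by (auto simp: sin_zero_iff_int2)
    have "2 * lam * t = pi * of_int (if lam > 0 then i else - i)"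
      using i lam by (auto simp: \<theta>_def mult.commute[of pi])
    with t(2) show False by blast
  qed
  have \<sigma>: "\<sigma> \<noteq> 0" using s lam by (simp add: \<sigma>_def)
  have C0: "C > 0" using C by (simp add: nazarov_constant_def)
  have calc: "hermite_calculus lam (\<lambda>r. exp (- \<i> * complex_of_real (\<tau> * r))) u0 (u \<tau>)" if "\<tau> \<ge> 0" for \<tau>
    using u that by (auto simp: hermite_schrodinger_solution_def)
  \<comment> \<open>at time 0 the spectral multiplier is 1, so the solution provides a limit of the expansion of the data\<close>
  have "L2_tendsto S (u 0)"
    using calc[of 0] by (simp add: hermite_calculus_def S_def[abs_def])
  then have S_lim: "L2_tendsto S u0"
    unfolding S_def[abs_def] by (rule hermite_expansion_tendsto[OF C lam u0])
  have Fu_lim: "L2_tendsto (\<lambda>N x. \<Sum>k<N. exp (- \<i> * complex_of_real (t * ((2 * real k + real CARD('n)) * \<bar>lam\<bar>))) * hermite_proj lam k u0 x) (u t)"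
    using calc[of t] t by (simp add: hermite_calculus_def)
  have ut: "u t \<in> L2_space" using Fu_lim by (simp add: L2_tendsto_def)
  have chirp_meas: "chirp a \<in> borel_measurable (lebesgue :: (real ^ 'n) measure)"
    by (rule measurable_completion) measurable
  have factor_meas: "schrodinger_factor lam \<theta> \<in> borel_measurable (lebesgue :: (real ^ 'n) measure)"
    unfolding schrodinger_factor_def[abs_def] Let_def by (rule measurable_completion) measurable
  have factor_norm: "norm (schrodinger_factor lam \<theta> \<xi>) = sqrt (\<bar>\<sigma>\<bar> ^ CARD('n))" for \<xi> :: "real ^ 'n"
    using norm_schrodinger_factor[OF lam s, of \<xi>] by (simp add: \<sigma>_def real_sqrt_unique)
  \<comment> \<open>multiplication by functions of constant modulus and dilations preserve convergence in the mean\<close>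
  have f_lim: "L2_tendsto (\<lambda>N x. chirp a x * S N x) f"
    unfolding f_def[abs_def] by (rule L2_tendsto_mult_const_norm[OF S_lim chirp_meas norm_chirp])
  have f2: "f \<in> L2_space" using f_lim by (simp add: L2_tendsto_def)
  have fg: "has_L2_fourier f g"
    unfolding has_L2_fourier_def
  proof (intro exI conjI allI)
    show "integrable lebesgue (\<lambda>x. chirp a x * S N x)" for N
      unfolding a_def S_def by (rule fourier_transform_chirped_partial_sum(2)[OF lam \<theta>_def s])
    show "L2_tendsto (\<lambda>N x. chirp a x * S N x) f" by (rule f_lim)
    have "L2_tendsto (\<lambda>N \<xi>. schrodinger_factor lam \<theta> \<xi> * (\<Sum>k<N. exp (- \<i> * complex_of_real (t * ((2 * real k + real CARD('n)) * \<bar>lam\<bar>))) * hermite_proj lam k u0 (\<sigma> *\<^sub>R \<xi>))) g"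
      unfolding g_def[abs_def]
      by (rule L2_tendsto_mult_const_norm[OF L2_tendsto_scaleR[OF \<sigma> Fu_lim] factor_meas factor_norm])
    then show "L2_tendsto (\<lambda>N. fourier_transform (\<lambda>x. chirp a x * S N x)) g"
      unfolding a_def S_def \<sigma>_def fourier_transform_chirped_partial_sum(1)[OF lam \<theta>_def s, abs_def] .
  qed
  have B'_eq: "B' = (\<lambda>x. inverse \<sigma> *\<^sub>R x + 0) ` B"
  proof (intro set_eqI iffI)
    fix \<xi> assume "\<xi> \<in> B'"
    then show "\<xi> \<in> (\<lambda>x. inverse \<sigma> *\<^sub>R x + 0) ` B"
      using \<sigma> by (intro image_eqI[of _ _ "\<sigma> *\<^sub>R \<xi>"]) (simp_all add: B'_def)
  qed (use \<sigma> in \<open>auto simp: B'_def\<close>)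
  have B'_sets: "B' \<in> sets lebesgue"
    using measurable_sets[OF lebesgue_measurable_scaling[of \<sigma>] fmeasurableD[OF B(1)]]
    by (simp add: B'_def vimage_def)
  have B'_fin: "B' \<in> lmeasurable"
  proof (rule fmeasurableI[OF B'_sets])
    have "emeasure lebesgue B' = \<bar>inverse \<sigma>\<bar> ^ CARD('n) * emeasure lebesgue B"
      unfolding B'_eq using emeasure_lebesgue_affine[of "inverse \<sigma>" 0 B] by simp
    then show "emeasure lebesgue B' < \<infinity>"
      using fmeasurableD2[OF B(1)]
      by (simp add: ennreal_mult_less_top less_top del: emeasure_completion)
  qed
  have B'_meas: "measure lebesgue B' = \<bar>inverse \<sigma>\<bar> ^ CARD('n) * measure lebesgue B"
    unfolding B'_eq using measure_lebesgue_affine[of "inverse \<sigma>" 0 B] by simp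
  have nazarov: "(LINT x|lebesgue. (norm (f x))\<^sup>2)
      \<le> C * exp (C * measure lebesgue A * measure lebesgue B') *
        ((LINT x:-A|lebesgue. (norm (f x))\<^sup>2) + (LINT \<xi>:-B'|lebesgue. (norm (g \<xi>))\<^sup>2))"
    using C[unfolded nazarov_constant_def, THEN conjunct2, rule_format, OF A(1) B'_fin f2 fg] .
  have f_norm: "norm (f x) = norm (u0 x)" for x by (simp add: f_def norm_mult)
  \<comment> \<open>the squared modulus of the factor is the Jacobian of the dilation\<close>
  have g_int: "(LINT \<xi>:-B'|lebesgue. (norm (g \<xi>))\<^sup>2) = (LINT x:-B|lebesgue. (norm (u t x))\<^sup>2)"
  proof -
    let ?h = "\<lambda>x. indicator (- B) x *\<^sub>R (norm (u t x))\<^sup>2"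
    have "- B \<in> sets lebesgue" using fmeasurableD[OF B(1)] by (simp add: Compl_in_sets_lebesgue)
    then have h: "?h \<in> borel_measurable lebesgue"
      using borel_measurable_integrable[OF L2_spaceD(2)[OF ut]]
      by (intro borel_measurable_scaleR borel_measurable_indicator)
    have "indicator (- B') \<xi> *\<^sub>R (norm (g \<xi>))\<^sup>2 = \<bar>\<sigma>\<bar> ^ CARD('n) *\<^sub>R ?h (\<sigma> *\<^sub>R \<xi>)" for \<xi>
      by (simp add: g_def norm_mult factor_norm power_mult_distrib B'_def indicator_def)
    then show ?thesis
      using integral_lebesgue_scaleR[OF \<sigma> h] by (simp add: set_lebesgue_integral_def)
  qed
  have "C * measure lebesgue A * measure lebesgue B' \<le> C * \<bar>sin (2 * \<bar>lam\<bar> * t)\<bar> powi (- int CARD('n)) * \<bar>lam\<bar> ^ CARD('n) *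
                measure lebesgue A * measure lebesgue B"
  proof -
    \<comment> \<open>the left-hand side is smaller by the factor (2 pi)^d, which is given away\<close>
    have "\<bar>inverse \<sigma>\<bar> ^ CARD('n) \<le> (\<bar>lam\<bar> / \<bar>sin \<theta>\<bar>) ^ CARD('n)"
    proof (rule power_mono)
      have "\<bar>inverse \<sigma>\<bar> = (\<bar>lam\<bar> / \<bar>sin \<theta>\<bar>) / (2 * pi)"
        by (simp add: \<sigma>_def abs_mult field_simps)
      also have "\<dots> \<le> (\<bar>lam\<bar> / \<bar>sin \<theta>\<bar>) / 1"
        using pi_ge_two by (intro divide_left_mono) auto
      finally show "\<bar>inverse \<sigma>\<bar> \<le> \<bar>lam\<bar> / \<bar>sin \<theta>\<bar>" by simp
    qed simp
    also have "\<dots> = \<bar>sin (2 * \<bar>lam\<bar> * t)\<bar> powi (- int CARD('n)) * \<bar>lam\<bar> ^ CARD('n)"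
      by (simp add: \<theta>_def power_int_minus power_mult_distrib divide_inverse mult.commute power_inverse)
    finally have "C * measure lebesgue A * measure lebesgue B * \<bar>inverse \<sigma>\<bar> ^ CARD('n) \<le>
        C * measure lebesgue A * measure lebesgue B * (\<bar>sin (2 * \<bar>lam\<bar> * t)\<bar> powi (- int CARD('n)) * \<bar>lam\<bar> ^ CARD('n))"
      using C0 A B by (intro mult_left_mono) auto
    then show ?thesis unfolding B'_meas by (simp only: mult_ac)
  qed
  then have "C * exp (C * measure lebesgue A * measure lebesgue B') *
        ((LINT x:-A|lebesgue. (norm (u0 x))\<^sup>2) + (LINT x:-B|lebesgue. (norm (u t x))\<^sup>2)) \<le>
      C * exp (C * \<bar>sin (2 * \<bar>lam\<bar> * t)\<bar> powi (- int CARD('n)) * \<bar>lam\<bar> ^ CARD('n) *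
                measure lebesgue A * measure lebesgue B) *
        ((LINT x:-A|lebesgue. (norm (u0 x))\<^sup>2) + (LINT x:-B|lebesgue. (norm (u t x))\<^sup>2))"
    using C0 by (intro mult_right_mono mult_left_mono add_nonneg_nonneg)
      (auto simp: set_lebesgue_integral_def)
  with nazarov show ?thesis by (simp only: f_norm g_int)
qed

end
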